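(* Let $C$ be a diamond category and let $\Gamma$ be a finite group. Define the category $\Gamma$-$C$ in which objects are pairs of an object $G\in C$ and a homomorphism $\Gamma\to\mathrm{Aut}(G)$, and morphisms are epimorphisms in $C$ compatible with the action of $\Gamma$. Then $\Gamma$-$C$ is a diamond category.
   Context: Let $C$ be a small category. A quotient of an object $G$ is a pair $(F,\pi)$ of an object $F$ and an epimorphism $\pi:G\to F$; quotients $(F,\pi),(F',\pi')$ are isomorphic if there is an isomorphism $\rho:F\to F'$ with $\pi'=\rho\pi$. Isomorphism classes of quotients of $G$ form a poset, where $H\ge F$ if there is $h:H\to F$ compatible with the morphisms from $G$; joins $\vee$ and meets $\wedge$ of quotients of $G$ are taken in this poset. A lattice (poset in which any two elements have a join and a meet) is modular if $a\le b$ implies $a\vee(x\wedge b)=(a\vee x)\wedge b$ for all $x$. For $F$ a quotient of $G$, $[F,G]$ is the poset of isomorphism classes of quotients of $G$ that are $\ge F$. An object is minimal if it has only one quotient (itself). A set $\mathcal{S}$ of objects, stable under isomorphism (equivalently a set of isomorphism classes), is downward-closed if every quotient of an object of $\mathcal{S}$ is in $\mathcal{S}$; it is join-closed if whenever $H,F\in\mathcal{S}$ are quotients of some object $G$ and $H\vee F$ exists, $H\vee F\in\mathcal{S}$. A level is a set of isomorphism classes generated by a finite set $B$ of isomorphism classes, i.e. the smallest downward-closed join-closed set containing $B$ and every minimal object. An epimorphism $G\to F$ is simple if it is not an isomorphism and $[F,G]$ contains only $F$ and $G$. A diamond category is a small category $C$ such that: (1) for each object $G$, the set of isomorphism classes of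 quotients of $G$ is a finite modular lattice; (2) each object has finite automorphism group; (3) for each level $\mathcal{L}$ and each $G\in\mathcal{L}$, there are finitely many elements of $\mathcal{L}$ with a simple epimorphism to $G$; (4) $C$ has at most countably many isomorphism classes of minimal objects. The paper never considers morphisms of $C$ that are not epimorphisms, and allows non-epimorphisms to be removed from $C$ for convenience. *)

theory Defs
  imports "HOL-Algebra.Group" "HOL-Library.Countable_Set"
begin

text \<open>
  A small category is given by a set of objects and a set of morphisms for each ordered pair of
  objects. Hom-sets need not be disjoint, which is why a quotient below is a pair of an object and
  an epimorphism; every small category arises in this way, for instance from one with disjoint
  hom-sets. \<open>Comp C g f\<close> is the composite ``\<open>f\<close> first, then \<open>g\<close>''.
  Nothing is required of the fields outside the set of objects.
\<close>

record ('o, 'm) cat =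
  Ob :: "'o set"
  Hom :: "'o \<Rightarrow> 'o \<Rightarrow> 'm set"
  Comp :: "'m \<Rightarrow> 'm \<Rightarrow> 'm"
  Ident :: "'o \<Rightarrow> 'm"

locale small_category =
  fixes C :: "('o, 'm) cat"
  assumes Comp_closed:
      "\<lbrakk>X \<in> Ob C; Y \<in> Ob C; Z \<in> Ob C; f \<in> Hom C X Y; g \<in> Hom C Y Z\<rbrakk> \<Longrightarrow> Comp C g f \<in> Hom C X Z"
    and Ident_closed: "X \<in> Ob C \<Longrightarrow> Ident C X \<in> Hom C X X"
    and Comp_Ident_right:
      "\<lbrakk>X \<in> Ob C; Y \<in> Ob C; f \<in> Hom C X Y\<rbrakk> \<Longrightarrow> Comp C f (Ident C X) = f"
    and Comp_Ident_left:
      "\<lbrakk>X \<in> Ob C; Y \<in> Ob C; f \<in> Hom C X Y\<rbrakk> \<Longrightarrow> Comp C (Ident C Y) f = f"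
    and Comp_assoc:
      "\<lbrakk>W \<in> Ob C; X \<in> Ob C; Y \<in> Ob C; Z \<in> Ob C; f \<in> Hom C W X; g \<in> Hom C X Y; h \<in> Hom C Y Z\<rbrakk>
        \<Longrightarrow> Comp C h (Comp C g f) = Comp C (Comp C h g) f"

definition epi :: "('o, 'm) cat \<Rightarrow> 'o \<Rightarrow> 'o \<Rightarrow> 'm \<Rightarrow> bool" where
  "epi C X Y f \<longleftrightarrow> f \<in> Hom C X Y \<and>
     (\<forall>Z\<in>Ob C. \<forall>g\<in>Hom C Y Z. \<forall>h\<in>Hom C Y Z. Comp C g f = Comp C h f \<longrightarrow> g = h)"

definition isom :: "('o, 'm) cat \<Rightarrow> 'o \<Rightarrow> 'o \<Rightarrow> 'm \<Rightarrow> bool" where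
  "isom C X Y f \<longleftrightarrow> f \<in> Hom C X Y \<and>
     (\<exists>g\<in>Hom C Y X. Comp C g f = Ident C X \<and> Comp C f g = Ident C Y)"

definition Aut :: "('o, 'm) cat \<Rightarrow> 'o \<Rightarrow> 'm monoid" where
  "Aut C X = \<lparr>carrier = {f. isom C X X f}, mult = Comp C, one = Ident C X\<rparr>"

definition iso_rel :: "('o, 'm) cat \<Rightarrow> ('o \<times> 'o) set" where
  "iso_rel C = {(X, Y). X \<in> Ob C \<and> Y \<in> Ob C \<and> (\<exists>f. isom C X Y f)}"

definition iso_classes :: "('o, 'm) cat \<Rightarrow> 'o set set" where
  "iso_classes C = Ob C // iso_rel C"


subsection \<open>Quotients\<close>

definition quotients :: "('o, 'm) cat \<Rightarrow> 'o \<Rightarrow> ('o \<times> 'm) set" where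
  "quotients C G = {(F, \<pi>). F \<in> Ob C \<and> epi C G F \<pi>}"

definition quot_rel :: "('o, 'm) cat \<Rightarrow> 'o \<Rightarrow> (('o \<times> 'm) \<times> ('o \<times> 'm)) set" where
  "quot_rel C G = {((F, \<pi>), (F', \<pi>')). (F, \<pi>) \<in> quotients C G \<and> (F', \<pi>') \<in> quotients C G \<and>
     (\<exists>\<rho>. isom C F F' \<rho> \<and> \<pi>' = Comp C \<rho> \<pi>)}"

definition quot_class :: "('o, 'm) cat \<Rightarrow> 'o \<Rightarrow> 'o \<Rightarrow> 'm \<Rightarrow> ('o \<times> 'm) set" where
  "quot_class C G F \<pi> = quot_rel C G `` {(F, \<pi>)}"

text \<open>Comparability does not depend on the representatives, so existence of some comparable pair
  of representatives is the right relation on classes.\<close>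

definition quot_poset :: "('o, 'm) cat \<Rightarrow> 'o \<Rightarrow> ('o \<times> 'm) set gorder" where
  "quot_poset C G =
     \<lparr>carrier = quotients C G // quot_rel C G,
      eq = (=),
      le = (\<lambda>P Q. \<exists>(F, \<pi>)\<in>P. \<exists>(H, \<eta>)\<in>Q. \<exists>h\<in>Hom C H F. \<pi> = Comp C h \<eta>)\<rparr>"

locale modular_lattice = lattice L for L (structure) +
  assumes modular:
    "\<lbrakk>a \<in> carrier L; b \<in> carrier L; x \<in> carrier L; a \<sqsubseteq> b\<rbrakk> \<Longrightarrow> a \<squnion> (x \<sqinter> b) = (a \<squnion> x) \<sqinter> b"

text \<open>The interval $[F,G]$ for a quotient $\pi : G \to F$.\<close>

definition quot_interval :: "('o, 'm) cat \<Rightarrow> 'o \<Rightarrow> 'o \<Rightarrow> 'm \<Rightarrow> ('o \<times> 'm) set set" where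
  "quot_interval C G F \<pi> =
     {P \<in> carrier (quot_poset C G). quot_class C G F \<pi> \<sqsubseteq>\<^bsub>quot_poset C G\<^esub> P}"

definition simple_epi :: "('o, 'm) cat \<Rightarrow> 'o \<Rightarrow> 'o \<Rightarrow> 'm \<Rightarrow> bool" where
  "simple_epi C G F \<pi> \<longleftrightarrow> epi C G F \<pi> \<and> \<not> isom C G F \<pi> \<and>
     quot_interval C G F \<pi> = {quot_class C G F \<pi>, quot_class C G G (Ident C G)}"

definition minimal_object :: "('o, 'm) cat \<Rightarrow> 'o \<Rightarrow> bool" where
  "minimal_object C G \<longleftrightarrow> G \<in> Ob C \<and>
     carrier (quot_poset C G) = {quot_class C G G (Ident C G)}"


subsection \<open>Levels\<close>

text \<open>Sets of isomorphism classes are represented by isomorphism-stable sets of objects, except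
  for the generating set of a level and where classes are counted.\<close>

definition iso_stable :: "('o, 'm) cat \<Rightarrow> 'o set \<Rightarrow> bool" where
  "iso_stable C S \<longleftrightarrow> S \<subseteq> Ob C \<and> (\<forall>X\<in>S. \<forall>Y. (X, Y) \<in> iso_rel C \<longrightarrow> Y \<in> S)"

definition downward_closed :: "('o, 'm) cat \<Rightarrow> 'o set \<Rightarrow> bool" where
  "downward_closed C S \<longleftrightarrow> (\<forall>G\<in>S. \<forall>(F, \<pi>)\<in>quotients C G. F \<in> S)"

definition join_closed :: "('o, 'm) cat \<Rightarrow> 'o set \<Rightarrow> bool" where
  "join_closed C S \<longleftrightarrow>
     (\<forall>G\<in>Ob C. \<forall>(H, \<eta>)\<in>quotients C G. \<forall>(F, \<pi>)\<in>quotients C G. \<forall>(J, \<theta>)\<in>quotients C G.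
        H \<in> S \<longrightarrow> F \<in> S \<longrightarrow>
        is_lub (quot_poset C G) (quot_class C G J \<theta>) {quot_class C G H \<eta>, quot_class C G F \<pi>} \<longrightarrow>
        J \<in> S)"

definition generated_level :: "('o, 'm) cat \<Rightarrow> 'o set set \<Rightarrow> 'o set" where
  "generated_level C B =
     \<Inter>{S. iso_stable C S \<and> downward_closed C S \<and> join_closed C S \<and>
         \<Union>B \<subseteq> S \<and> {G. minimal_object C G} \<subseteq> S}"

definition is_level :: "('o, 'm) cat \<Rightarrow> 'o set \<Rightarrow> bool" where
  "is_level C L \<longleftrightarrow> (\<exists>B. finite B \<and> B \<subseteq> iso_classes C \<and> L = generated_level C B)"


subsection \<open>Diamond categories\<close>

locale diamond_category = small_category C for C :: "('o, 'm) cat" +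
  assumes finite_quotients: "G \<in> Ob C \<Longrightarrow> finite (carrier (quot_poset C G))"
    and modular_quotients: "G \<in> Ob C \<Longrightarrow> modular_lattice (quot_poset C G)"
    and finite_Aut: "G \<in> Ob C \<Longrightarrow> finite (carrier (Aut C G))"
    and finite_simple_epi: "\<lbrakk>is_level C L; G \<in> L\<rbrakk> \<Longrightarrow>
          finite {K \<in> iso_classes C. \<exists>H\<in>K. H \<in> L \<and> (\<exists>\<pi>. simple_epi C H G \<pi>)}"
    and countable_minimal: "countable {K \<in> iso_classes C. \<exists>G\<in>K. minimal_object C G}"

text \<open>
  The category $\Gamma$-$C$. Since HOL functions are total, a homomorphism
  $\Gamma \to \mathrm{Aut}(G)$ is normalised to be \<open>undefined\<close> outside the carrier of $\Gamma$;
  this makes an action the same thing as the HOL function representing it.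
\<close>

definition equivariant_cat ::
    "('g, 'b) monoid_scheme \<Rightarrow> ('o, 'm) cat \<Rightarrow> ('o \<times> ('g \<Rightarrow> 'm), 'm) cat" where
  "equivariant_cat \<Gamma> C =
     \<lparr>Ob = {(G, \<rho>). G \<in> Ob C \<and> \<rho> \<in> hom \<Gamma> (Aut C G) \<inter> extensional (carrier \<Gamma>)},
      Hom = (\<lambda>(G, \<rho>) (H, \<sigma>).
        {f. epi C G H f \<and> (\<forall>\<gamma>\<in>carrier \<Gamma>. Comp C f (\<rho> \<gamma>) = Comp C (\<sigma> \<gamma>) f)}),
      Comp = Comp C,
      Ident = (\<lambda>(G, \<rho>). Ident C G)\<rparr>"

end

theory Submission
  imports Defs
begin

text \<open>
  Write \<open>D\<close> for the category \<open>\<Gamma>\<close>-\<open>C\<close>. Everything rests on comparing the quotients of an object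
  \<open>(G, \<rho>)\<close> of \<open>D\<close> with the quotients of \<open>G\<close> in \<open>C\<close>. Forgetting the actions embeds the first poset
  into the second: since the structure maps of quotients are epimorphisms, a morphism between
  quotients is equivariant as soon as it exists, and a quotient carries at most one compatible
  action. It carries one exactly when its class is fixed by the automorphisms of the lattice of
  quotients of \<open>G\<close> that the elements of \<open>\<Gamma>\<close> induce (\<open>forget_image_eq_invariants\<close>). Fixed points of
  order automorphisms are closed under joins and meets, so the quotients of \<open>(G, \<rho>)\<close> form a
  sublattice of a finite modular lattice (\<open>forget_modular_embedding\<close>).

  The least quotient of \<open>G\<close> is fixed by all automorphisms. Hence a minimal object of \<open>D\<close> has a
  minimal underlying object (\<open>minimal_object_underlying\<close>), and, joins being preserved, a level of
  \<open>D\<close> lies over a level of \<open>C\<close> (\<open>level_lies_over_level\<close>). As \<open>\<Gamma>\<close> and the automorphism groups of \<open>C\<close>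
  are finite, only finitely many isomorphism classes of \<open>D\<close> lie over one of \<open>C\<close>
  (\<open>finite_iso_classes_over\<close>). This settles the countability of minimal objects.

  A simple epimorphism \<open>(H, \<tau>) \<rightarrow> (G, \<rho>)\<close> of \<open>D\<close> need not be simple in \<open>C\<close>. But take a quotient of
  \<open>H\<close> covering \<open>G\<close>. The join of its \<open>\<Gamma>\<close>-translates is invariant and different from \<open>G\<close>, so it is \<open>H\<close>.
  By modularity, joining with one more translate is either no change or a cover, so \<open>H\<close> is reached
  from \<open>G\<close> by a tower of at most \<open>|\<Gamma>|\<close> simple epimorphisms of \<open>C\<close>
  (\<open>simple_epi_D_underlying_tower\<close>). All objects of the tower are quotients of \<open>H\<close>, hence stay in one
  level of \<open>C\<close>, where only finitely many towers of bounded length exist (\<open>finite_simple_towers\<close>).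
\<close>

section \<open>Modular lattices, automorphisms and embeddings\<close>

definition covers :: "('a, 'c) gorder_scheme \<Rightarrow> 'a \<Rightarrow> 'a \<Rightarrow> bool" where
  "covers L a b \<longleftrightarrow> a \<in> carrier L \<and> b \<in> carrier L \<and> a \<sqsubseteq>\<^bsub>L\<^esub> b \<and> a \<noteq> b \<and>
     (\<forall>p\<in>carrier L. a \<sqsubseteq>\<^bsub>L\<^esub> p \<longrightarrow> p \<sqsubseteq>\<^bsub>L\<^esub> b \<longrightarrow> p = a \<or> p = b)"

text \<open>
  For \<open>p\<close> between \<open>j\<close> and \<open>j \<squnion> k\<close>, modularity gives \<open>p = j \<squnion> (k \<sqinter> p)\<close>, and \<open>k \<sqinter> p\<close> lies in the
  two-element interval from \<open>g\<close> to \<open>k\<close>.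
\<close>

lemma (in modular_lattice) cover_join:
  assumes "covers L g k" "j \<in> carrier L" "g \<sqsubseteq> j"
  shows "j \<squnion> k = j \<or> covers L j (j \<squnion> k)"
proof -
  have k: "k \<in> carrier L" and g: "g \<in> carrier L" and gk: "g \<sqsubseteq> k"
    using assms(1) by (auto simp: covers_def)
  note j = assms(2)
  have "p = j \<or> p = j \<squnion> k" if p: "p \<in> carrier L" "j \<sqsubseteq> p" "p \<sqsubseteq> j \<squnion> k" for p
  proof -
    have "j \<squnion> (k \<sqinter> p) = (j \<squnion> k) \<sqinter> p"
      by (rule modular) (use j k p in auto)
    also have "\<dots> = p"
      using p j k by (metis le_iff_join join_closed meet_comm)
    finally have eq: "j \<squnion> (k \<sqinter> p) = p" .
    have "g \<sqsubseteq> p"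
      using le_trans[OF assms(3) p(2)] g j p by auto
    then have "g \<sqsubseteq> k \<sqinter> p"
      using meet_le gk k p g by auto
    moreover have "k \<sqinter> p \<sqsubseteq> k" "k \<sqinter> p \<in> carrier L"
      using meet_left k p by auto
    ultimately have "k \<sqinter> p = g \<or> k \<sqinter> p = k"
      using assms(1) by (auto simp: covers_def)
    moreover have "j \<squnion> g = j"
      using le_iff_meet[OF g j] assms(3) join_comm by metis
    ultimately show ?thesis
      using eq by auto
  qed
  then show ?thesis
    using j k join_left join_closed unfolding covers_def by metis
qed

lemma (in upper_semilattice) lub_insert:
  assumes j: "is_lub L j A" and A: "A \<subseteq> carrier L" and k: "k \<in> carrier L"
  shows "is_lub L (j \<squnion> k) (insert k A)"
proof (rule least_UpperI)
  have jc: "j \<in> carrier L" using j by auto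
  show "insert k A \<subseteq> carrier L" using A k by simp
  show "j \<squnion> k \<in> carrier L" using jc k by simp
  show "x \<sqsubseteq> j \<squnion> k" if "x \<in> insert k A" for x
    using that least_Upper_above[OF j] A jc k join_left[OF jc k] join_right[OF jc k]
      le_trans[of x j "j \<squnion> k"] by auto
  show "j \<squnion> k \<sqsubseteq> u" if u: "u \<in> Upper L (insert k A)" for u
  proof -
    have "u \<in> Upper L A" using u Upper_antimono[of A "insert k A"] by blast
    then show ?thesis
      using join_le[of j u k] least_le[OF j] u jc k A by (auto simp: Upper_def)
  qed
qed

lemma (in partial_order) exists_cover_above:
  assumes fin: "finite (carrier L)" and "g \<in> carrier L" "h \<in> carrier L" "g \<sqsubseteq> h" "g \<noteq> h"
  shows "\<exists>k. covers L g k"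
proof -
  define A where "A = {p \<in> carrier L. g \<sqsubseteq> p \<and> g \<noteq> p}"
  have "\<exists>m\<in>A. \<forall>x\<in>A. x \<noteq> m \<longrightarrow> \<not> (x \<sqsubseteq> m \<and> x \<noteq> m)"
  proof (rule Finite_Set.bex_min_element)
    show "finite A"
      using fin by (auto simp: A_def)
    show "asymp_on A (\<lambda>x y. x \<sqsubseteq> y \<and> x \<noteq> y)"
      by (auto simp: asymp_on_def A_def dest: le_antisym)
    show "transp_on A (\<lambda>x y. x \<sqsubseteq> y \<and> x \<noteq> y)"
      by (rule transp_onI) (auto simp: A_def dest: le_antisym intro: le_trans)
    show "A \<noteq> {}"
      using assms by (auto simp: A_def)
  qed
  then obtain m where "m \<in> A" "\<And>x. x \<in> A \<Longrightarrow> x \<sqsubseteq> m \<Longrightarrow> x = m"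
    by blast
  then have "covers L g m"
    using assms(2) unfolding covers_def A_def by auto
  then show ?thesis ..
qed

text \<open>
  The inverse is a parameter because it has to be monotone as well, which does not follow from
  monotonicity of a bijection.
\<close>

locale order_automorphism = partial_order L for L (structure) +
  fixes t s :: "'a \<Rightarrow> 'a"
  assumes t_closed: "x \<in> carrier L \<Longrightarrow> t x \<in> carrier L"
    and s_closed: "x \<in> carrier L \<Longrightarrow> s x \<in> carrier L"
    and t_mono: "\<lbrakk>x \<in> carrier L; y \<in> carrier L; x \<sqsubseteq> y\<rbrakk> \<Longrightarrow> t x \<sqsubseteq> t y"
    and s_mono: "\<lbrakk>x \<in> carrier L; y \<in> carrier L; x \<sqsubseteq> y\<rbrakk> \<Longrightarrow> s x \<sqsubseteq> s y"
    and t_s: "x \<in> carrier L \<Longrightarrow> t (s x) = x"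
    and s_t: "x \<in> carrier L \<Longrightarrow> s (t x) = x"
begin

text \<open>
  As \<open>t\<close> and \<open>s\<close> permute \<open>A\<close>, both \<open>t j\<close> and \<open>s j\<close> are upper bounds of \<open>A\<close>, hence above \<open>j\<close>; applying \<open>t\<close>
  to \<open>j \<sqsubseteq> s j\<close> gives the reverse inequality.
\<close>

lemma lub_fixed:
  assumes j: "is_lub L j A" and A: "A \<subseteq> carrier L" and tA: "t ` A = A"
  shows "t j = j"
proof -
  have jc: "j \<in> carrier L"
    using j by auto
  have sA: "s ` A = A"
  proof -
    have "s ` A = s ` t ` A" using tA by simp
    also have "\<dots> = id ` A"
      unfolding image_image by (rule image_cong) (use A s_t in auto)
    also have "\<dots> = A" by simp
    finally show ?thesis .
  qed
  have le: "j \<sqsubseteq> u j"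
    if uj: "u j \<in> carrier L" and uA: "u ` A = A"
      and mono: "\<And>x y. \<lbrakk>x \<in> carrier L; y \<in> carrier L; x \<sqsubseteq> y\<rbrakk> \<Longrightarrow> u x \<sqsubseteq> u y" for u
  proof -
    have "u j \<in> Upper L A"
    proof (rule Upper_memI[OF _ uj])
      fix y assume "y \<in> A"
      then obtain x where "x \<in> A" "y = u x" using uA by blast
      moreover have "x \<sqsubseteq> j" using j \<open>x \<in> A\<close> A by (meson least_Upper_above)
      ultimately show "y \<sqsubseteq> u j" using mono A jc by auto
    qed
    then show ?thesis using j least_le by metis
  qed
  have "j \<sqsubseteq> t j" by (rule le) (use t_mono tA t_closed jc in auto)
  moreover have "j \<sqsubseteq> s j" by (rule le) (use s_mono sA s_closed jc in auto)
  then have "t j \<sqsubseteq> j" using t_mono[of j "s j"] t_s s_closed jc by auto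
  ultimately show ?thesis using le_antisym t_closed jc by auto
qed

lemma dual_automorphism: "order_automorphism (inv_gorder L) t s"
proof -
  interpret dual: partial_order "inv_gorder L" by (rule dual_order)
  show ?thesis
    by unfold_locales (use t_closed s_closed t_mono s_mono t_s s_t in auto)
qed

lemma glb_fixed:
  assumes "greatest L j (Lower L A)" "A \<subseteq> carrier L" "t ` A = A"
  shows "t j = j"
  using order_automorphism.lub_fixed[OF dual_automorphism, of j A] assms by simp

lemma cover_image:
  assumes "covers L g k"
  shows "covers L (t g) (t k)"
proof -
  have c: "g \<in> carrier L" "k \<in> carrier L" "g \<sqsubseteq> k" "g \<noteq> k"
    using assms by (auto simp: covers_def)
  have "t g \<noteq> t k" using c s_t by metis
  moreover have "p = t g \<or> p = t k" if "p \<in> carrier L" "t g \<sqsubseteq> p" "p \<sqsubseteq> t k" for p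
  proof -
    have "g \<sqsubseteq> s p" "s p \<sqsubseteq> k"
      using s_mono[of "t g" p] s_mono[of p "t k"] that c t_closed s_t by auto
    then have "s p = g \<or> s p = k"
      using assms s_closed that by (auto simp: covers_def)
    then show ?thesis using t_s that by metis
  qed
  ultimately show ?thesis using c t_closed t_mono by (auto simp: covers_def)
qed

end

text \<open>
  Up to isomorphism, \<open>M\<close> is the sublattice of \<open>L\<close> with elements \<open>f ` carrier M\<close>. That \<open>M\<close> is itself a
  modular lattice is the conclusion; its joins and meets are pulled back along \<open>f\<close>.
\<close>

locale modular_embedding = L: modular_lattice L for L :: "'a gorder" +
  fixes M :: "'b gorder" and f :: "'b \<Rightarrow> 'a"
  assumes eq_M: "eq M = (=)"
    and closed: "x \<in> carrier M \<Longrightarrow> f x \<in> carrier L"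
    and inj: "inj_on f (carrier M)"
    and le_iff: "\<lbrakk>x \<in> carrier M; y \<in> carrier M\<rbrakk> \<Longrightarrow> x \<sqsubseteq>\<^bsub>M\<^esub> y \<longleftrightarrow> f x \<sqsubseteq>\<^bsub>L\<^esub> f y"
    and join_range: "\<lbrakk>x \<in> carrier M; y \<in> carrier M\<rbrakk> \<Longrightarrow> f x \<squnion>\<^bsub>L\<^esub> f y \<in> f ` carrier M"
    and meet_range: "\<lbrakk>x \<in> carrier M; y \<in> carrier M\<rbrakk> \<Longrightarrow> f x \<sqinter>\<^bsub>L\<^esub> f y \<in> f ` carrier M"
begin

lemma partial_order_domain: "partial_order M"
proof unfold_locales
  fix x y z w
  show "x .=\<^bsub>M\<^esub> y" if "x \<sqsubseteq>\<^bsub>M\<^esub> y" "y \<sqsubseteq>\<^bsub>M\<^esub> x" "x \<in> carrier M" "y \<in> carrier M"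
    using that le_iff closed inj L.le_antisym by (auto simp: eq_M inj_on_def)
  show "x \<sqsubseteq>\<^bsub>M\<^esub> z" if "x \<sqsubseteq>\<^bsub>M\<^esub> y" "y \<sqsubseteq>\<^bsub>M\<^esub> z" "x \<in> carrier M" "y \<in> carrier M" "z \<in> carrier M"
    using that le_iff closed L.le_trans by meson
qed (auto simp: eq_M le_iff closed)

lemma lub_reflect:
  assumes "x \<in> carrier M" "y \<in> carrier M" "z \<in> carrier M" "f z = f x \<squnion>\<^bsub>L\<^esub> f y"
  shows "is_lub M z {x, y}"
proof (rule least_UpperI)
  show "u \<sqsubseteq>\<^bsub>M\<^esub> z" if "u \<in> {x, y}" for u
    using that assms le_iff closed L.join_left L.join_right by auto
  show "z \<sqsubseteq>\<^bsub>M\<^esub> u" if "u \<in> Upper M {x, y}" for u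
    using that assms le_iff closed L.join_le by (auto simp: Upper_def)
qed (use assms in auto)

lemma glb_reflect:
  assumes "x \<in> carrier M" "y \<in> carrier M" "z \<in> carrier M" "f z = f x \<sqinter>\<^bsub>L\<^esub> f y"
  shows "greatest M z (Lower M {x, y})"
proof (rule greatest_LowerI)
  show "z \<sqsubseteq>\<^bsub>M\<^esub> u" if "u \<in> {x, y}" for u
    using that assms le_iff closed L.meet_left L.meet_right by auto
  show "u \<sqsubseteq>\<^bsub>M\<^esub> z" if "u \<in> Lower M {x, y}" for u
    using that assms le_iff closed L.meet_le by (auto simp: Lower_def)
qed (use assms in auto)

lemma lattice_domain: "lattice M"
proof -
  interpret M: partial_order M by (rule partial_order_domain)
  show ?thesis
  proof unfold_locales
    fix x y assume xy: "x \<in> carrier M" "y \<in> carrier M"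
    show "\<exists>s. is_lub M s {x, y}"
      using join_range[OF xy] lub_reflect[OF xy] by (metis imageE)
    show "\<exists>s. greatest M s (Lower M {x, y})"
      using meet_range[OF xy] glb_reflect[OF xy] by (metis imageE)
  qed
qed

text \<open>
  The join of \<open>f x\<close> and \<open>f y\<close> has a preimage, which is a least upper bound of \<open>x\<close> and \<open>y\<close> and therefore
  equal to \<open>z\<close>.
\<close>

lemma lub_image:
  assumes "x \<in> carrier M" "y \<in> carrier M" "is_lub M z {x, y}"
  shows "f z = f x \<squnion>\<^bsub>L\<^esub> f y"
proof -
  interpret M: partial_order M by (rule partial_order_domain)
  show ?thesis
    using join_range[OF assms(1,2)] lub_reflect[OF assms(1,2)] assms(3) M.least_unique
    by (metis imageE)
qed

lemma glb_image:
  assumes "x \<in> carrier M" "y \<in> carrier M" "greatest M z (Lower M {x, y})"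
  shows "f z = f x \<sqinter>\<^bsub>L\<^esub> f y"
proof -
  interpret M: partial_order M by (rule partial_order_domain)
  show ?thesis
    using meet_range[OF assms(1,2)] glb_reflect[OF assms(1,2)] assms(3) M.greatest_unique
    by (metis imageE)
qed

lemma modular_lattice_domain: "modular_lattice M"
proof -
  interpret M: lattice M by (rule lattice_domain)
  have join: "f (x \<squnion>\<^bsub>M\<^esub> y) = f x \<squnion>\<^bsub>L\<^esub> f y" if "x \<in> carrier M" "y \<in> carrier M" for x y
    unfolding join_def[of M] using lub_image that M.sup_of_two_least by metis
  have meet: "f (x \<sqinter>\<^bsub>M\<^esub> y) = f x \<sqinter>\<^bsub>L\<^esub> f y" if "x \<in> carrier M" "y \<in> carrier M" for x y
    unfolding meet_def[of M] using glb_image that M.inf_of_two_greatest by metis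
  show ?thesis
  proof unfold_locales
    fix a b x assume *: "a \<in> carrier M" "b \<in> carrier M" "x \<in> carrier M" "a \<sqsubseteq>\<^bsub>M\<^esub> b"
    then have "f (a \<squnion>\<^bsub>M\<^esub> (x \<sqinter>\<^bsub>M\<^esub> b)) = f ((a \<squnion>\<^bsub>M\<^esub> x) \<sqinter>\<^bsub>M\<^esub> b)"
      by (simp add: join meet L.modular closed le_iff)
    then show "a \<squnion>\<^bsub>M\<^esub> (x \<sqinter>\<^bsub>M\<^esub> b) = (a \<squnion>\<^bsub>M\<^esub> x) \<sqinter>\<^bsub>M\<^esub> b"
      using inj_onD[OF inj] * by simp
  qed
qed

end


section \<open>Quotients in a small category\<close>

context small_category
begin

lemma epi_Hom: "epi C X Y f \<Longrightarrow> f \<in> Hom C X Y"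
  by (simp add: epi_def)

lemma epi_cancel:
  "\<lbrakk>epi C X Y f; Z \<in> Ob C; g \<in> Hom C Y Z; h \<in> Hom C Y Z; Comp C g f = Comp C h f\<rbrakk> \<Longrightarrow> g = h"
  by (auto simp: epi_def)

lemma epi_Comp:
  assumes Ob: "X \<in> Ob C" "Y \<in> Ob C" "Z \<in> Ob C" and f: "epi C X Y f" and g: "epi C Y Z g"
  shows "epi C X Z (Comp C g f)"
  unfolding epi_def
proof (intro conjI ballI impI)
  show "Comp C g f \<in> Hom C X Z"
    using Comp_closed Ob epi_Hom f g by metis
  fix W p q assume *: "W \<in> Ob C" "p \<in> Hom C Z W" "q \<in> Hom C Z W"
    "Comp C p (Comp C g f) = Comp C q (Comp C g f)"
  then have "Comp C (Comp C p g) f = Comp C (Comp C q g) f"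
    using Comp_assoc[of X Y Z W f g p] Comp_assoc[of X Y Z W f g q] Ob epi_Hom[OF f] epi_Hom[OF g]
    by simp
  then have "Comp C p g = Comp C q g"
    using epi_cancel[OF f *(1)] * Comp_closed[of Y Z W g] Ob epi_Hom[OF g] by simp
  then show "p = q" using epi_cancel[OF g] * by metis
qed

lemma epi_of_epi_Comp:
  assumes Ob: "X \<in> Ob C" "Y \<in> Ob C" "Z \<in> Ob C" and f: "f \<in> Hom C X Y" and g: "g \<in> Hom C Y Z"
    and gf: "epi C X Z (Comp C g f)"
  shows "epi C Y Z g"
  unfolding epi_def
proof (intro conjI ballI impI)
  fix W p q assume *: "W \<in> Ob C" "p \<in> Hom C Z W" "q \<in> Hom C Z W" "Comp C p g = Comp C q g"
  then have "Comp C p (Comp C g f) = Comp C q (Comp C g f)"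
    using Comp_assoc[of X Y Z W f g p] Comp_assoc[of X Y Z W f g q] Ob f g by simp
  then show "p = q" using epi_cancel[OF gf] * by metis
qed (rule g)

lemma isom_Hom: "isom C X Y f \<Longrightarrow> f \<in> Hom C X Y"
  by (simp add: isom_def)

lemma isom_inverse:
  assumes "isom C X Y f"
  obtains g where "isom C Y X g" "Comp C g f = Ident C X" "Comp C f g = Ident C Y"
  using assms by (auto simp: isom_def)

lemma isom_epi:
  assumes Ob: "X \<in> Ob C" "Y \<in> Ob C" and f: "isom C X Y f"
  shows "epi C X Y f"
  unfolding epi_def
proof (intro conjI ballI impI)
  show "f \<in> Hom C X Y" using f by (rule isom_Hom)
  obtain f' where f': "isom C Y X f'" "Comp C f f' = Ident C Y" using f isom_inverse by metis
  fix W p q assume *: "W \<in> Ob C" "p \<in> Hom C Y W" "q \<in> Hom C Y W" "Comp C p f = Comp C q f"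
  have "u = Comp C (Comp C u f) f'" if "u \<in> Hom C Y W" for u
    using Comp_assoc[of Y X Y W f' f u] Comp_Ident_right[of Y W u] f' isom_Hom f Ob * that by simp
  then show "p = q" using * by metis
qed

lemma isom_Ident: "X \<in> Ob C \<Longrightarrow> isom C X X (Ident C X)"
  using Ident_closed Comp_Ident_left by (auto simp: isom_def)

lemma isom_Comp:
  assumes Ob: "X \<in> Ob C" "Y \<in> Ob C" "Z \<in> Ob C" and f: "isom C X Y f" and g: "isom C Y Z g"
  shows "isom C X Z (Comp C g f)"
proof -
  obtain f' where f': "isom C Y X f'" "Comp C f' f = Ident C X" "Comp C f f' = Ident C Y"
    using f isom_inverse by metis
  obtain g' where g': "isom C Z Y g'" "Comp C g' g = Ident C Y" "Comp C g g' = Ident C Z"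
    using g isom_inverse by metis
  note H = isom_Hom[OF f] isom_Hom[OF g] isom_Hom[OF f'(1)] isom_Hom[OF g'(1)]
  have "Comp C g' (Comp C g f) = f"
    using Comp_assoc[of X Y Z Y f g g'] Comp_Ident_left[of X Y f] Ob H g' by simp
  then have 1: "Comp C (Comp C f' g') (Comp C g f) = Ident C X"
    using Comp_assoc[of X Z Y X "Comp C g f" g' f'] Comp_closed[of X Y Z f g] Ob H f' by simp
  have "Comp C f (Comp C f' g') = g'"
    using Comp_assoc[of Z Y X Y g' f' f] Comp_Ident_left[of Z Y g'] Ob H f' by simp
  then have 2: "Comp C (Comp C g f) (Comp C f' g') = Ident C Z"
    using Comp_assoc[of Z X Y Z "Comp C f' g'" f g] Comp_closed[of Z Y X g' f'] Ob H g' by simp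
  show ?thesis
    unfolding isom_def
    using 1 2 Comp_closed[of X Y Z f g] Comp_closed[of Z Y X g' f'] Ob H by auto
qed

text \<open>
  Both composites of \<open>h\<close> and \<open>k\<close> become identities after cancelling the epimorphisms \<open>\<pi>\<close> and \<open>\<eta>\<close>.
  This is antisymmetry of the order on quotients.
\<close>

lemma isom_of_mutual_factorization:
  assumes Ob: "G \<in> Ob C" "F \<in> Ob C" "H \<in> Ob C" and \<pi>: "epi C G F \<pi>" and \<eta>: "epi C G H \<eta>"
    and h: "h \<in> Hom C H F" "\<pi> = Comp C h \<eta>" and k: "k \<in> Hom C F H" "\<eta> = Comp C k \<pi>"
  shows "isom C F H k"
proof -
  have "Comp C (Comp C h k) \<pi> = Comp C (Ident C F) \<pi>"
    using Comp_assoc[of G F H F \<pi> k h] Comp_Ident_left[of G F \<pi>] Ob h(1) k(1)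
      epi_Hom[OF \<pi>] by (simp flip: h(2) k(2))
  then have 1: "Comp C h k = Ident C F"
    using epi_cancel[OF \<pi> Ob(2)] Ob h(1) k(1) Comp_closed[of F H F k h] Ident_closed by simp
  have "Comp C (Comp C k h) \<eta> = Comp C (Ident C H) \<eta>"
    using Comp_assoc[of G H F H \<eta> h k] Comp_Ident_left[of G H \<eta>] Ob h(1) k(1)
      epi_Hom[OF \<eta>] by (simp flip: h(2) k(2))
  then have "Comp C k h = Ident C H"
    using epi_cancel[OF \<eta> Ob(3)] Ob h(1) k(1) Comp_closed[of H F H h k] Ident_closed by simp
  with 1 show ?thesis using h k by (auto simp: isom_def)
qed

lemma quotients_iff: "(F, \<pi>) \<in> quotients C G \<longleftrightarrow> F \<in> Ob C \<and> epi C G F \<pi>"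
  by (simp add: quotients_def)

lemma Ident_quotient: "G \<in> Ob C \<Longrightarrow> (G, Ident C G) \<in> quotients C G"
  by (simp add: quotients_iff isom_epi isom_Ident)

lemma equiv_iso_rel: "equiv (Ob C) (iso_rel C)"
proof (rule equivI)
  show "iso_rel C \<subseteq> Ob C \<times> Ob C" by (auto simp: iso_rel_def)
  show "refl_on (Ob C) (iso_rel C)"
    using isom_Ident by (auto simp: refl_on_def iso_rel_def)
  show "sym (iso_rel C)"
    by (auto simp: sym_def iso_rel_def elim: isom_inverse)
  show "trans (iso_rel C)"
    by (rule transI) (auto simp: iso_rel_def intro: isom_Comp)
qed

lemma equiv_quot_rel:
  assumes G: "G \<in> Ob C"
  shows "equiv (quotients C G) (quot_rel C G)"
proof (rule equivI)
  show "quot_rel C G \<subseteq> quotients C G \<times> quotients C G"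
    by (auto simp: quot_rel_def)
  show "refl_on (quotients C G) (quot_rel C G)"
    using isom_Ident Comp_Ident_left G epi_Hom
    by (force simp: refl_on_def quot_rel_def quotients_iff)
  show "sym (quot_rel C G)"
  proof (rule symI, clarsimp simp: quot_rel_def)
    fix F \<pi> F' r
    assume *: "(F, \<pi>) \<in> quotients C G" "(F', Comp C r \<pi>) \<in> quotients C G" "isom C F F' r"
    then obtain r' where r': "isom C F' F r'" "Comp C r' r = Ident C F"
      using isom_inverse by metis
    have "\<pi> = Comp C r' (Comp C r \<pi>)"
      using Comp_assoc[of G F F' F \<pi> r r'] Comp_Ident_left[of G F \<pi>] r' * G isom_Hom epi_Hom
      by (auto simp: quotients_iff)
    then show "\<exists>\<rho>. isom C F' F \<rho> \<and> \<pi> = Comp C \<rho> (Comp C r \<pi>)" using r' by auto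
  qed
  show "trans (quot_rel C G)"
  proof (rule transI, clarsimp simp: quot_rel_def)
    fix F \<pi> F' r F'' r'
    assume *: "(F, \<pi>) \<in> quotients C G" "isom C F F' r" "isom C F' F'' r'"
      "(F', Comp C r \<pi>) \<in> quotients C G" "(F'', Comp C r' (Comp C r \<pi>)) \<in> quotients C G"
    then have "Comp C r' (Comp C r \<pi>) = Comp C (Comp C r' r) \<pi>"
      using Comp_assoc[of G F F' F'' \<pi> r r'] G isom_Hom epi_Hom by (auto simp: quotients_iff)
    moreover have "isom C F F'' (Comp C r' r)"
      using isom_Comp[of F F' F'' r r'] * by (auto simp: quotients_iff)
    ultimately show "\<exists>\<rho>. isom C F F'' \<rho> \<and> Comp C r' (Comp C r \<pi>) = Comp C \<rho> \<pi>" by metis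
  qed
qed

lemma mem_quot_class_iff:
  "(F', \<pi>') \<in> quot_class C G F \<pi> \<longleftrightarrow> (F, \<pi>) \<in> quotients C G \<and> (F', \<pi>') \<in> quotients C G \<and>
     (\<exists>r. isom C F F' r \<and> \<pi>' = Comp C r \<pi>)"
  by (simp add: quot_class_def quot_rel_def)

lemma quot_class_self:
  "\<lbrakk>G \<in> Ob C; (F, \<pi>) \<in> quotients C G\<rbrakk> \<Longrightarrow> (F, \<pi>) \<in> quot_class C G F \<pi>"
  using equiv_class_self[OF equiv_quot_rel] by (auto simp: quot_class_def)

lemma quot_class_eq_iff:
  assumes "G \<in> Ob C" "(F, \<pi>) \<in> quotients C G" "(F', \<pi>') \<in> quotients C G"
  shows "quot_class C G F \<pi> = quot_class C G F' \<pi>' \<longleftrightarrow> (\<exists>r. isom C F F' r \<and> \<pi>' = Comp C r \<pi>)"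
  using equiv_class_eq_iff[OF equiv_quot_rel[OF assms(1)], of "(F, \<pi>)" "(F', \<pi>')"]
    eq_equiv_class_iff[OF equiv_quot_rel[OF assms(1)], of "(F, \<pi>)" "(F', \<pi>')"] assms(2,3)
  by (auto simp: quot_class_def quot_rel_def)

lemma quot_class_carrier:
  "(F, \<pi>) \<in> quotients C G \<Longrightarrow> quot_class C G F \<pi> \<in> carrier (quot_poset C G)"
  by (simp add: quot_poset_def quot_class_def quotientI)

lemma quot_poset_cases:
  assumes "P \<in> carrier (quot_poset C G)"
  obtains F \<pi> where "(F, \<pi>) \<in> quotients C G" "P = quot_class C G F \<pi>"
  using assms by (auto simp: quot_poset_def quot_class_def elim!: quotientE)

text \<open>
  The order on classes is defined by existence of comparable representatives; composing with the
  isomorphisms between representatives reduces it to any chosen ones.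
\<close>

lemma quot_le_iff:
  assumes G: "G \<in> Ob C" and F: "(F, \<pi>) \<in> quotients C G" and H: "(H, \<eta>) \<in> quotients C G"
  shows "quot_class C G F \<pi> \<sqsubseteq>\<^bsub>quot_poset C G\<^esub> quot_class C G H \<eta> \<longleftrightarrow>
    (\<exists>h\<in>Hom C H F. \<pi> = Comp C h \<eta>)"
proof
  assume "\<exists>h\<in>Hom C H F. \<pi> = Comp C h \<eta>"
  then show "quot_class C G F \<pi> \<sqsubseteq>\<^bsub>quot_poset C G\<^esub> quot_class C G H \<eta>"
    using quot_class_self[OF G F] quot_class_self[OF G H] by (fastforce simp: quot_poset_def)
next
  assume "quot_class C G F \<pi> \<sqsubseteq>\<^bsub>quot_poset C G\<^esub> quot_class C G H \<eta>"
  then obtain F' \<pi>' H' \<eta>' h where *: "(F', \<pi>') \<in> quot_class C G F \<pi>"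
    "(H', \<eta>') \<in> quot_class C G H \<eta>" "h \<in> Hom C H' F'" "\<pi>' = Comp C h \<eta>'"
    by (auto simp: quot_poset_def)
  obtain r where r: "isom C F F' r" "\<pi>' = Comp C r \<pi>" "F' \<in> Ob C"
    using *(1) by (auto simp: mem_quot_class_iff quotients_iff)
  obtain q where q: "isom C H H' q" "\<eta>' = Comp C q \<eta>" "H' \<in> Ob C"
    using *(2) by (auto simp: mem_quot_class_iff quotients_iff)
  obtain r' where r': "isom C F' F r'" "Comp C r' r = Ident C F"
    using r(1) isom_inverse by metis
  have Ob: "F \<in> Ob C" "H \<in> Ob C" and e: "\<pi> \<in> Hom C G F" "\<eta> \<in> Hom C G H"
    using F H epi_Hom by (auto simp: quotients_iff)
  note m = isom_Hom[OF r(1)] isom_Hom[OF r'(1)] isom_Hom[OF q(1)] *(3) e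
  have "\<pi> = Comp C r' (Comp C r \<pi>)"
    using Comp_assoc[of G F F' F \<pi> r r'] Comp_Ident_left[of G F \<pi>] r' r(3) m Ob G by simp
  also have "\<dots> = Comp C r' (Comp C h (Comp C q \<eta>))"
    using r q * by simp
  also have "\<dots> = Comp C (Comp C r' (Comp C h q)) \<eta>"
    using Comp_assoc[of G H H' F' \<eta> q h] Comp_assoc[of G H F' F \<eta> "Comp C h q" r']
      Comp_closed[of H H' F' q h] m Ob r(3) q(3) G by simp
  finally show "\<exists>h\<in>Hom C H F. \<pi> = Comp C h \<eta>"
    using Comp_closed[of H H' F' q h] Comp_closed[of H F' F "Comp C h q" r'] m Ob r(3) q(3) by auto
qed

lemma quot_poset_partial_order:
  assumes G: "G \<in> Ob C"
  shows "partial_order (quot_poset C G)"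
proof -
  have eq: "eq (quot_poset C G) = (=)" by (simp add: quot_poset_def)
  show ?thesis
  proof unfold_locales
    fix P Q R S
    show "P \<sqsubseteq>\<^bsub>quot_poset C G\<^esub> P" if "P \<in> carrier (quot_poset C G)"
      using that
    proof (cases rule: quot_poset_cases)
      case (1 F \<pi>)
      then show ?thesis
        using quot_le_iff[OF G 1(1) 1(1)] Ident_closed[of F] Comp_Ident_left[of G F \<pi>] G epi_Hom
        by (metis quotients_iff)
    qed
    show "P .=\<^bsub>quot_poset C G\<^esub> Q" if PQ: "P \<sqsubseteq>\<^bsub>quot_poset C G\<^esub> Q" "Q \<sqsubseteq>\<^bsub>quot_poset C G\<^esub> P"
      and P: "P \<in> carrier (quot_poset C G)" and Q: "Q \<in> carrier (quot_poset C G)"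
    proof -
      obtain F \<pi> where F: "(F, \<pi>) \<in> quotients C G" "P = quot_class C G F \<pi>"
        using P by (rule quot_poset_cases)
      obtain H \<eta> where H: "(H, \<eta>) \<in> quotients C G" "Q = quot_class C G H \<eta>"
        using Q by (rule quot_poset_cases)
      obtain h k where h: "h \<in> Hom C H F" "\<pi> = Comp C h \<eta>"
        and k: "k \<in> Hom C F H" "\<eta> = Comp C k \<pi>"
        using PQ quot_le_iff[OF G] F H by auto
      have "F \<in> Ob C" "H \<in> Ob C" "epi C G F \<pi>" "epi C G H \<eta>"
        using F(1) H(1) by (auto simp: quotients_iff)
      then have "isom C F H k"
        using isom_of_mutual_factorization[OF G _ _ _ _ h k] by blast
      then have "quot_class C G F \<pi> = quot_class C G H \<eta>"
        using quot_class_eq_iff[OF G F(1) H(1)] k(2) by blast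
      then show ?thesis
        by (simp add: eq F(2) H(2))
    qed
    show "P \<sqsubseteq>\<^bsub>quot_poset C G\<^esub> R" if PQ: "P \<sqsubseteq>\<^bsub>quot_poset C G\<^esub> Q" "Q \<sqsubseteq>\<^bsub>quot_poset C G\<^esub> R"
      and P: "P \<in> carrier (quot_poset C G)" and Q: "Q \<in> carrier (quot_poset C G)"
      and R: "R \<in> carrier (quot_poset C G)"
    proof -
      obtain F \<pi> where F: "(F, \<pi>) \<in> quotients C G" "P = quot_class C G F \<pi>"
        using P by (rule quot_poset_cases)
      obtain H \<eta> where H: "(H, \<eta>) \<in> quotients C G" "Q = quot_class C G H \<eta>"
        using Q by (rule quot_poset_cases)
      obtain K \<kappa> where K: "(K, \<kappa>) \<in> quotients C G" "R = quot_class C G K \<kappa>"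
        using R by (rule quot_poset_cases)
      obtain h k where hk: "h \<in> Hom C H F" "\<pi> = Comp C h \<eta>" "k \<in> Hom C K H" "\<eta> = Comp C k \<kappa>"
        using PQ quot_le_iff[OF G] F H K by auto
      have Ob: "F \<in> Ob C" "H \<in> Ob C" "K \<in> Ob C" "\<kappa> \<in> Hom C G K"
        using F H K epi_Hom by (auto simp: quotients_iff)
      have "\<pi> = Comp C (Comp C h k) \<kappa>" "Comp C h k \<in> Hom C K F"
        using hk Ob G Comp_assoc[of G K H F \<kappa> k h] Comp_closed[of K H F k h] by auto
      then show ?thesis using quot_le_iff[OF G F(1) K(1)] F K by auto
    qed
  qed (auto simp: eq)
qed

lemma quot_class_Ident_greatest:
  assumes G: "G \<in> Ob C" and P: "P \<in> carrier (quot_poset C G)"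
  shows "P \<sqsubseteq>\<^bsub>quot_poset C G\<^esub> quot_class C G G (Ident C G)"
proof -
  obtain F \<pi> where F: "(F, \<pi>) \<in> quotients C G" "P = quot_class C G F \<pi>"
    using P by (rule quot_poset_cases)
  then show ?thesis
    using quot_le_iff[OF G F(1) Ident_quotient[OF G]] Comp_Ident_right[of G F \<pi>] epi_Hom G
    by (metis quotients_iff)
qed

lemma quot_class_eq_Ident_iff:
  assumes G: "G \<in> Ob C" and F: "(F, \<pi>) \<in> quotients C G"
  shows "quot_class C G F \<pi> = quot_class C G G (Ident C G) \<longleftrightarrow> isom C G F \<pi>"
  using quot_class_eq_iff[OF G Ident_quotient[OF G] F] Comp_Ident_right[of G F] isom_Hom F G
  by (metis quotients_iff)

text \<open>
  Precomposition with \<open>\<kappa>\<close> turns a quotient of \<open>K\<close> above \<open>F\<close> into a quotient of \<open>G\<close> between \<open>F\<close> and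
  \<open>K\<close>, and \<open>\<kappa>\<close> can be cancelled to come back. So the interval \<open>[F, K]\<close> has as few elements as the
  corresponding interval of quotients of \<open>G\<close>.
\<close>

lemma simple_epi_of_cover:
  assumes G: "G \<in> Ob C" and K: "(K, \<kappa>) \<in> quotients C G" and F: "(F, \<phi>) \<in> quotients C G"
    and cov: "covers (quot_poset C G) (quot_class C G F \<phi>) (quot_class C G K \<kappa>)"
  shows "\<exists>h. simple_epi C K F h"
proof -
  have Ob: "K \<in> Ob C" "F \<in> Ob C" and e: "epi C G K \<kappa>" "epi C G F \<phi>"
    using K F by (auto simp: quotients_iff)
  obtain h where h: "h \<in> Hom C K F" "\<phi> = Comp C h \<kappa>"
    using cov quot_le_iff[OF G F K] by (auto simp: covers_def)
  have eh: "epi C K F h"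
    using epi_of_epi_Comp[of G K F \<kappa> h] G Ob h e epi_Hom by auto
  then have qh: "(F, h) \<in> quotients C K" using Ob by (simp add: quotients_iff)
  have nh: "\<not> isom C K F h"
    using cov quot_class_eq_iff[OF G K F] h(2) by (auto simp: covers_def)
  have "quot_interval C K F h \<subseteq> {quot_class C K F h, quot_class C K K (Ident C K)}"
  proof
    fix Q assume "Q \<in> quot_interval C K F h"
    then have Q: "Q \<in> carrier (quot_poset C K)" "quot_class C K F h \<sqsubseteq>\<^bsub>quot_poset C K\<^esub> Q"
      by (auto simp: quot_interval_def)
    obtain P p where P: "(P, p) \<in> quotients C K" "Q = quot_class C K P p"
      using Q(1) by (rule quot_poset_cases)
    obtain k where k: "k \<in> Hom C P F" "h = Comp C k p"
      using Q(2) quot_le_iff[OF Ob(1) qh P(1)] P(2) by auto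
    have PO: "P \<in> Ob C" and ep: "epi C K P p" using P by (auto simp: quotients_iff)
    have pk: "(P, Comp C p \<kappa>) \<in> quotients C G"
      using epi_Comp[OF G Ob(1) PO e(1) ep] PO by (simp add: quotients_iff)
    have "\<phi> = Comp C k (Comp C p \<kappa>)"
      using h k Comp_assoc[of G K P F \<kappa> p k] G Ob PO epi_Hom[OF e(1)] epi_Hom[OF ep] by simp
    then have "quot_class C G F \<phi> \<sqsubseteq>\<^bsub>quot_poset C G\<^esub> quot_class C G P (Comp C p \<kappa>)"
      using quot_le_iff[OF G F pk] k by auto
    moreover have "quot_class C G P (Comp C p \<kappa>) \<sqsubseteq>\<^bsub>quot_poset C G\<^esub> quot_class C G K \<kappa>"
      using quot_le_iff[OF G pk K] epi_Hom[OF ep] by auto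
    ultimately consider "quot_class C G P (Comp C p \<kappa>) = quot_class C G F \<phi>"
      | "quot_class C G P (Comp C p \<kappa>) = quot_class C G K \<kappa>"
      using cov quot_class_carrier[OF pk] by (auto simp: covers_def)
    then show "Q \<in> {quot_class C K F h, quot_class C K K (Ident C K)}"
    proof cases
      case 1
      then obtain r where r: "isom C P F r" "\<phi> = Comp C r (Comp C p \<kappa>)"
        using quot_class_eq_iff[OF G pk F] by auto
      have "Comp C h \<kappa> = Comp C (Comp C r p) \<kappa>"
        using r(2) h Comp_assoc[of G K P F \<kappa> p r] G Ob PO
          epi_Hom[OF e(1)] epi_Hom[OF ep] isom_Hom[OF r(1)] by simp
      then have "h = Comp C r p"
        using epi_cancel[OF e(1) Ob(2) h(1)] Ob PO
          Comp_closed[of K P F p r] epi_Hom[OF ep] isom_Hom[OF r(1)] by simp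
      then show ?thesis using quot_class_eq_iff[OF Ob(1) P(1) qh] r P(2) by auto
    next
      case 2
      then obtain r where r: "isom C P K r" "\<kappa> = Comp C r (Comp C p \<kappa>)"
        using quot_class_eq_iff[OF G pk K] by auto
      have "Comp C (Ident C K) \<kappa> = Comp C (Comp C r p) \<kappa>"
        using r(2) Comp_assoc[of G K P K \<kappa> p r] Comp_Ident_left[of G K \<kappa>] G Ob PO
          epi_Hom[OF e(1)] epi_Hom[OF ep] isom_Hom[OF r(1)] by simp
      then have "Ident C K = Comp C r p"
        using epi_cancel[OF e(1) Ob(1) Ident_closed[OF Ob(1)]] Ob PO
          Comp_closed[of K P K p r] epi_Hom[OF ep] isom_Hom[OF r(1)] by simp
      then show ?thesis
        using quot_class_eq_iff[OF Ob(1) P(1) Ident_quotient[OF Ob(1)]] r P(2) by auto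
    qed
  qed
  moreover have "{quot_class C K F h, quot_class C K K (Ident C K)} \<subseteq> quot_interval C K F h"
    using quot_class_carrier[OF qh] quot_class_carrier[OF Ident_quotient[OF Ob(1)]]
      quot_class_Ident_greatest[OF Ob(1)] partial_order.axioms(1)[OF quot_poset_partial_order[OF Ob(1)]]
      weak_partial_order.le_refl
    by (fastforce simp: quot_interval_def)
  ultimately show ?thesis
    unfolding simple_epi_def using eh nh by blast
qed

text \<open>
  Composing with \<open>r\<close> does not change the class of the quotient, and simplicity depends on that class
  only.
\<close>

lemma simple_epi_target_iso:
  assumes Ob: "X \<in> Ob C" "Y \<in> Ob C" "Y' \<in> Ob C" and s: "simple_epi C X Y \<pi>" and r: "isom C Y Y' r"
  shows "simple_epi C X Y' (Comp C r \<pi>)"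
proof -
  have e: "epi C X Y \<pi>" using s by (simp add: simple_epi_def)
  have e': "epi C X Y' (Comp C r \<pi>)" by (rule epi_Comp[OF Ob e isom_epi[OF Ob(2,3) r]])
  have q: "(Y, \<pi>) \<in> quotients C X" "(Y', Comp C r \<pi>) \<in> quotients C X"
    using e e' Ob by (auto simp: quotients_iff)
  have eq: "quot_class C X Y' (Comp C r \<pi>) = quot_class C X Y \<pi>"
    using quot_class_eq_iff[OF Ob(1) q] r by auto
  moreover have "\<not> isom C X Y' (Comp C r \<pi>)"
    using quot_class_eq_Ident_iff[OF Ob(1)] q eq s by (metis simple_epi_def)
  ultimately show ?thesis
    using e' s by (simp add: simple_epi_def quot_interval_def)
qed

text \<open>
  The right action of automorphisms of \<open>G\<close> on its quotients, by precomposition. It is taken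
  elementwise on classes, so that no representative has to be chosen.
\<close>

definition twist :: "'m \<Rightarrow> ('o \<times> 'm) set \<Rightarrow> ('o \<times> 'm) set" where
  "twist a P = (\<lambda>(F, \<pi>). (F, Comp C \<pi> a)) ` P"

lemma twist_quotient:
  assumes "G \<in> Ob C" "isom C G G a" "(F, \<pi>) \<in> quotients C G"
  shows "(F, Comp C \<pi> a) \<in> quotients C G"
  using epi_Comp isom_epi assms by (auto simp: quotients_iff)

lemma twist_quot_class:
  assumes G: "G \<in> Ob C" and a: "isom C G G a" and F: "(F, \<pi>) \<in> quotients C G"
  shows "twist a (quot_class C G F \<pi>) = quot_class C G F (Comp C \<pi> a)"
proof (intro equalityI subsetI)
  fix x assume "x \<in> twist a (quot_class C G F \<pi>)"
  then obtain F' r where x: "x = (F', Comp C (Comp C r \<pi>) a)" "isom C F F' r"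
    "(F', Comp C r \<pi>) \<in> quotients C G"
    by (auto simp: twist_def mem_quot_class_iff)
  moreover have "Comp C (Comp C r \<pi>) a = Comp C r (Comp C \<pi> a)"
    using Comp_assoc[of G G F F' a \<pi> r] isom_Hom a x F G epi_Hom by (auto simp: quotients_iff)
  ultimately show "x \<in> quot_class C G F (Comp C \<pi> a)"
    using twist_quotient[OF G a F] twist_quotient[OF G a x(3)] by (auto simp: mem_quot_class_iff)
next
  fix x assume "x \<in> quot_class C G F (Comp C \<pi> a)"
  then obtain F' r where x: "x = (F', Comp C r (Comp C \<pi> a))" "isom C F F' r" "F' \<in> Ob C"
    by (cases x) (auto simp: mem_quot_class_iff quotients_iff)
  moreover have "Comp C (Comp C r \<pi>) a = Comp C r (Comp C \<pi> a)"
    using Comp_assoc[of G G F F' a \<pi> r] isom_Hom a x F G epi_Hom by (auto simp: quotients_iff)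
  moreover have "(F', Comp C r \<pi>) \<in> quot_class C G F \<pi>"
    using F x epi_Comp[of G F F' \<pi> r] isom_epi G by (auto simp: mem_quot_class_iff quotients_iff)
  ultimately show "x \<in> twist a (quot_class C G F \<pi>)"
    unfolding twist_def by force
qed

lemma twist_closed:
  assumes "G \<in> Ob C" "isom C G G a" "P \<in> carrier (quot_poset C G)"
  shows "twist a P \<in> carrier (quot_poset C G)"
  using assms(3)
proof (cases rule: quot_poset_cases)
  case (1 F \<pi>)
  then show ?thesis
    using twist_quot_class[OF assms(1,2)] twist_quotient[OF assms(1,2)] quot_class_carrier by simp
qed

lemma twist_Comp:
  assumes G: "G \<in> Ob C" and a: "isom C G G a" and b: "isom C G G b"
    and P: "P \<in> carrier (quot_poset C G)"
  shows "twist a (twist b P) = twist (Comp C b a) P"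
proof -
  obtain F \<pi> where F: "(F, \<pi>) \<in> quotients C G" "P = quot_class C G F \<pi>"
    using P by (rule quot_poset_cases)
  have "Comp C (Comp C \<pi> b) a = Comp C \<pi> (Comp C b a)"
    using Comp_assoc[of G G G F a b \<pi>] isom_Hom a b F G epi_Hom by (auto simp: quotients_iff)
  then show ?thesis
    using twist_quot_class[OF G] twist_quotient[OF G] a b F isom_Comp[OF G G G a b] by simp
qed

lemma twist_Ident:
  assumes G: "G \<in> Ob C" and P: "P \<in> carrier (quot_poset C G)"
  shows "twist (Ident C G) P = P"
proof -
  obtain F \<pi> where F: "(F, \<pi>) \<in> quotients C G" "P = quot_class C G F \<pi>"
    using P by (rule quot_poset_cases)
  then show ?thesis
    using twist_quot_class[OF G isom_Ident[OF G]] Comp_Ident_right[of G F \<pi>] epi_Hom G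
    by (auto simp: quotients_iff)
qed

lemma twist_mono:
  assumes G: "G \<in> Ob C" and a: "isom C G G a" and P: "P \<in> carrier (quot_poset C G)"
    and Q: "Q \<in> carrier (quot_poset C G)" and le: "P \<sqsubseteq>\<^bsub>quot_poset C G\<^esub> Q"
  shows "twist a P \<sqsubseteq>\<^bsub>quot_poset C G\<^esub> twist a Q"
proof -
  obtain F \<pi> where F: "(F, \<pi>) \<in> quotients C G" "P = quot_class C G F \<pi>"
    using P by (rule quot_poset_cases)
  obtain H \<eta> where H: "(H, \<eta>) \<in> quotients C G" "Q = quot_class C G H \<eta>"
    using Q by (rule quot_poset_cases)
  obtain h where h: "h \<in> Hom C H F" "\<pi> = Comp C h \<eta>"
    using le quot_le_iff[OF G F(1) H(1)] F H by auto
  have "Comp C \<pi> a = Comp C h (Comp C \<eta> a)"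
    using h Comp_assoc[of G G H F a \<eta> h] isom_Hom a F H G epi_Hom by (auto simp: quotients_iff)
  then show ?thesis
    using quot_le_iff[OF G twist_quotient[OF G a F(1)] twist_quotient[OF G a H(1)]]
      twist_quot_class[OF G a] F H h by auto
qed

lemma twist_order_automorphism:
  assumes G: "G \<in> Ob C" and a: "isom C G G a" and b: "isom C G G b"
    and "Comp C a b = Ident C G" "Comp C b a = Ident C G"
  shows "order_automorphism (quot_poset C G) (twist a) (twist b)"
proof -
  interpret partial_order "quot_poset C G" by (rule quot_poset_partial_order[OF G])
  show ?thesis
    by unfold_locales
      (use twist_closed twist_mono twist_Comp twist_Ident assms in auto)
qed

end

section \<open>Levels and towers of simple epimorphisms\<close>

context small_category
begin

lemma iso_class_subset_Ob: "K \<in> iso_classes C \<Longrightarrow> K \<subseteq> Ob C"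
  using in_quotient_imp_subset[OF equiv_iso_rel] by (simp add: iso_classes_def)

text \<open>
  The intersection that defines a level therefore ranges over a nonempty family, and a level consists
  of objects.
\<close>

lemma Ob_is_closed:
  assumes "B \<subseteq> iso_classes C"
  shows "iso_stable C (Ob C) \<and> downward_closed C (Ob C) \<and> join_closed C (Ob C) \<and>
    \<Union>B \<subseteq> Ob C \<and> {G. minimal_object C G} \<subseteq> Ob C"
  using iso_class_subset_Ob assms
  by (auto simp: iso_stable_def iso_rel_def downward_closed_def join_closed_def quotients_iff
      minimal_object_def)

lemma level_subset_Ob: "is_level C L \<Longrightarrow> L \<subseteq> Ob C"
  unfolding is_level_def generated_level_def using Ob_is_closed by blast

lemma level_iso_stable:
  assumes "is_level C L"
  shows "iso_stable C L"
proof -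
  obtain B where L: "L = generated_level C B"
    using assms by (auto simp: is_level_def)
  show ?thesis
    unfolding iso_stable_def
  proof (intro conjI ballI allI impI)
    show "L \<subseteq> Ob C" using assms by (rule level_subset_Ob)
    show "Y \<in> L" if "X \<in> L" "(X, Y) \<in> iso_rel C" for X Y
      using that unfolding L generated_level_def iso_stable_def by blast
  qed
qed

lemma level_downward_closed:
  assumes "is_level C L"
  shows "downward_closed C L"
proof -
  obtain B where L: "L = generated_level C B"
    using assms by (auto simp: is_level_def)
  show ?thesis
    unfolding downward_closed_def
  proof clarify
    show "F \<in> L" if "G \<in> L" "(F, \<pi>) \<in> quotients C G" for G F \<pi>
      using that unfolding L generated_level_def downward_closed_def by blast
  qed
qed

lemma join_closedD:
  assumes "join_closed C S" "G \<in> Ob C"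
    and "(H, \<eta>) \<in> quotients C G" "(F, \<pi>) \<in> quotients C G" "(J, \<theta>) \<in> quotients C G"
    and "H \<in> S" "F \<in> S"
    and "is_lub (quot_poset C G) (quot_class C G J \<theta>) {quot_class C G H \<eta>, quot_class C G F \<pi>}"
  shows "J \<in> S"
  using assms unfolding join_closed_def by (fastforce dest: bspec)

lemma level_join_closed:
  assumes "is_level C L"
  shows "join_closed C L"
proof -
  obtain B where L: "L = generated_level C B"
    using assms by (auto simp: is_level_def)
  show ?thesis
    unfolding join_closed_def
  proof clarify
    fix G H \<eta> F \<pi> J \<theta>
    assume *: "G \<in> Ob C" "(H, \<eta>) \<in> quotients C G" "(F, \<pi>) \<in> quotients C G" "(J, \<theta>) \<in> quotients C G"
      and HF: "H \<in> L" "F \<in> L"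
      and lub: "is_lub (quot_poset C G) (quot_class C G J \<theta>)
        {quot_class C G H \<eta>, quot_class C G F \<pi>}"
    show "J \<in> L"
      unfolding L generated_level_def
    proof (rule InterI)
      fix S
      assume S: "S \<in> {S. iso_stable C S \<and> downward_closed C S \<and> join_closed C S \<and>
         \<Union>B \<subseteq> S \<and> {G. minimal_object C G} \<subseteq> S}"
      then have "H \<in> S" "F \<in> S" using HF unfolding L generated_level_def by blast+
      then show "J \<in> S" using S join_closedD[OF _ * _ _ lub] by blast
    qed
  qed
qed

end

text \<open>
  \<open>G\<close> and the objects of \<open>L\<close> that reach it by at most \<open>n\<close> simple epimorphisms through \<open>L\<close>. Stage
  zero is \<open>G\<close> alone and not its isomorphism class, so the stages need not be stable under
  isomorphism; statements below speak of the isomorphism classes that meet a stage.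
\<close>

primrec simple_towers :: "('o, 'm) cat \<Rightarrow> 'o set \<Rightarrow> 'o \<Rightarrow> nat \<Rightarrow> 'o set" where
  "simple_towers C L G 0 = {G}"
| "simple_towers C L G (Suc n) = simple_towers C L G n \<union>
     {X \<in> L. \<exists>Y\<in>simple_towers C L G n. \<exists>\<pi>. simple_epi C X Y \<pi>}"

lemma simple_towers_mono: "m \<le> n \<Longrightarrow> simple_towers C L G m \<subseteq> simple_towers C L G n"
  by (induction n rule: nat_induct) (auto simp: le_Suc_eq)

lemma simple_towers_subset: "G \<in> L \<Longrightarrow> simple_towers C L G n \<subseteq> L"
  by (induction n) auto

context diamond_category
begin

text \<open>
  By induction: one representative \<open>?rep K\<close> is chosen in each of the finitely many classes that meet
  stage \<open>n\<close>. A simple epimorphism to an element of stage \<open>n\<close> can be redirected to the representative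
  of its class, and there are finitely many classes with a simple epimorphism to each representative.
\<close>

lemma finite_simple_towers:
  assumes L: "is_level C L" and G: "G \<in> L"
  shows "finite {K \<in> iso_classes C. K \<inter> simple_towers C L G n \<noteq> {}}"
proof (induction n)
  case 0
  have "{K \<in> iso_classes C. K \<inter> simple_towers C L G 0 \<noteq> {}} \<subseteq> {iso_rel C `` {G}}"
    using quotient_eq_iff[OF equiv_iso_rel] equiv_class_self[OF equiv_iso_rel] level_subset_Ob[OF L] G
    by (fastforce simp: iso_classes_def intro!: quotientI)
  then show ?case by (rule finite_subset) simp
next
  case (Suc n)
  let ?\<K> = "{K \<in> iso_classes C. K \<inter> simple_towers C L G n \<noteq> {}}"
  let ?rep = "\<lambda>K. SOME Y. Y \<in> K"
  let ?above = "\<lambda>Y. {K \<in> iso_classes C. \<exists>X\<in>K. X \<in> L \<and> (\<exists>\<pi>. simple_epi C X Y \<pi>)}"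
  have LOb: "L \<subseteq> Ob C" using L by (rule level_subset_Ob)
  have rep: "?rep K \<in> L" "(Y, ?rep K) \<in> iso_rel C"
    if K: "K \<in> iso_classes C" and Y: "Y \<in> K" "Y \<in> simple_towers C L G n" for K Y
  proof -
    have "?rep K \<in> K" using Y by (auto intro: someI)
    then show "(Y, ?rep K) \<in> iso_rel C"
      using K Y quotient_eq_iff[OF equiv_iso_rel, of K K Y "?rep K"] by (auto simp: iso_classes_def)
    moreover have "Y \<in> L" using Y simple_towers_subset[OF G] by blast
    ultimately show "?rep K \<in> L" using level_iso_stable[OF L] by (auto simp: iso_stable_def)
  qed
  have "{K \<in> iso_classes C. K \<inter> simple_towers C L G (Suc n) \<noteq> {}} \<subseteq>
    ?\<K> \<union> (\<Union>K\<in>?\<K>. ?above (?rep K))"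
  proof
    fix K assume "K \<in> {K \<in> iso_classes C. K \<inter> simple_towers C L G (Suc n) \<noteq> {}}"
    then obtain X where K: "K \<in> iso_classes C" and X: "X \<in> K" "X \<in> simple_towers C L G (Suc n)"
      by blast
    show "K \<in> ?\<K> \<union> (\<Union>K\<in>?\<K>. ?above (?rep K))"
    proof (cases "X \<in> simple_towers C L G n")
      case True
      then show ?thesis using K X by blast
    next
      case False
      then obtain Y \<pi> where Y: "X \<in> L" "Y \<in> simple_towers C L G n" "simple_epi C X Y \<pi>"
        using X by auto
      then have YL: "Y \<in> L" using simple_towers_subset[OF G] by blast
      let ?K' = "iso_rel C `` {Y}"
      have K': "?K' \<in> iso_classes C" "Y \<in> ?K'"
        using YL LOb equiv_class_self[OF equiv_iso_rel] by (auto simp: iso_classes_def quotientI)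
      obtain r where "isom C Y (?rep ?K') r"
        using rep(2)[OF K' Y(2)] by (auto simp: iso_rel_def)
      then have "simple_epi C X (?rep ?K') (Comp C r \<pi>)"
        using simple_epi_target_iso[of X Y "?rep ?K'" \<pi> r] Y YL LOb rep(1)[OF K' Y(2)] by blast
      then have "K \<in> ?above (?rep ?K')" using K X(1) Y(1) by blast
      moreover have "?K' \<in> ?\<K>" using K' Y(2) by blast
      ultimately show ?thesis by blast
    qed
  qed
  moreover have "finite (?above (?rep K))" if "K \<in> ?\<K>" for K
    using that finite_simple_epi[OF L] rep(1) by blast
  ultimately show ?case using Suc by (meson finite_UN_I finite_UnI finite_subset)
qed

text \<open>
  The covers are joined one at a time. By \<open>cover_join\<close> each step leaves the join unchanged or gives a
  cover of it, hence a simple epimorphism. The intermediate objects are quotients of \<open>H\<close>, so they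
  remain in \<open>L\<close>.
\<close>

lemma join_of_covers_in_simple_towers:
  assumes H: "H \<in> Ob C" "H \<in> L" and L: "downward_closed C L" and G: "(G, \<pi>) \<in> quotients C H"
    and "finite A" and "\<And>k. k \<in> A \<Longrightarrow> covers (quot_poset C H) (quot_class C H G \<pi>) k"
  shows "\<exists>X \<theta>. (X, \<theta>) \<in> quotients C H \<and> X \<in> simple_towers C L G (card A) \<and>
    is_lub (quot_poset C H) (quot_class C H X \<theta>) (insert (quot_class C H G \<pi>) A)"
  using assms(5,6)
proof (induction A rule: finite_induct)
  interpret Q: modular_lattice "quot_poset C H" by (rule modular_quotients[OF H(1)])
  case empty
  show ?case
    using G Q.sup_of_singletonI quot_class_carrier[OF G] by auto
next
  interpret Q: modular_lattice "quot_poset C H" by (rule modular_quotients[OF H(1)])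
  case (insert k A)
  let ?g = "quot_class C H G \<pi>"
  obtain X \<theta> where X: "(X, \<theta>) \<in> quotients C H" "X \<in> simple_towers C L G (card A)"
    and lub: "is_lub (quot_poset C H) (quot_class C H X \<theta>) (insert ?g A)"
    using insert by blast
  let ?j = "quot_class C H X \<theta>"
  let ?jk = "?j \<squnion>\<^bsub>quot_poset C H\<^esub> k"
  have cov: "covers (quot_poset C H) ?g k" using insert by simp
  have gA: "insert ?g A \<subseteq> carrier (quot_poset C H)" and k: "k \<in> carrier (quot_poset C H)"
    using insert.prems quot_class_carrier[OF G] by (auto simp: covers_def)
  have j: "?j \<in> carrier (quot_poset C H)" using X by (simp add: quot_class_carrier)
  have gj: "?g \<sqsubseteq>\<^bsub>quot_poset C H\<^esub> ?j" using least_Upper_above[OF lub] gA by auto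
  have lub': "is_lub (quot_poset C H) ?jk (insert ?g (insert k A))"
    using Q.lub_insert[OF lub gA k] by (simp add: insert_commute)
  have card: "card (insert k A) = Suc (card A)" using insert by simp
  consider "?jk = ?j" | "covers (quot_poset C H) ?j ?jk"
    using Q.cover_join[OF cov j gj] by blast
  then show ?case
  proof cases
    case 1
    then show ?thesis using X lub' by (auto simp: card)
  next
    case 2
    have "?jk \<in> carrier (quot_poset C H)" using j k by simp
    then obtain X' \<theta>' where X': "(X', \<theta>') \<in> quotients C H" "?jk = quot_class C H X' \<theta>'"
      by (rule quot_poset_cases)
    have "\<exists>h. simple_epi C X' X h"
      using simple_epi_of_cover[OF H(1) X'(1) X(1)] 2 X'(2) by simp
    moreover have "X' \<in> L" using L H(2) X'(1) by (auto simp: downward_closed_def)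
    ultimately have "X' \<in> simple_towers C L G (card (insert k A))"
      using X(2) by (auto simp: card)
    then show ?thesis using X' lub' by metis
  qed
qed

end

section \<open>The category of equivariant objects\<close>

locale equivariant_objects = diamond_category C + \<Gamma>: group \<Gamma>
  for C :: "('o, 'm) cat" and \<Gamma> :: "('g, 'b) monoid_scheme" +
  assumes finite_group: "finite (carrier \<Gamma>)"
begin

abbreviation D :: "('o \<times> ('g \<Rightarrow> 'm), 'm) cat" where
  "D \<equiv> equivariant_cat \<Gamma> C"

lemma Ob_D: "(G, \<rho>) \<in> Ob D \<longleftrightarrow> G \<in> Ob C \<and> \<rho> \<in> hom \<Gamma> (Aut C G) \<and> \<rho> \<in> extensional (carrier \<Gamma>)"
  by (simp add: equivariant_cat_def)

lemma Hom_D: "f \<in> Hom D (G, \<rho>) (H, \<sigma>) \<longleftrightarrow>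
    epi C G H f \<and> (\<forall>\<gamma>\<in>carrier \<Gamma>. Comp C f (\<rho> \<gamma>) = Comp C (\<sigma> \<gamma>) f)"
  by (simp add: equivariant_cat_def)

lemma Comp_D [simp]: "Comp D = Comp C"
  by (simp add: equivariant_cat_def)

lemma Ident_D [simp]: "Ident D (G, \<rho>) = Ident C G"
  by (simp add: equivariant_cat_def)

lemma action_Ob: "(G, \<rho>) \<in> Ob D \<Longrightarrow> G \<in> Ob C"
  by (simp add: Ob_D)

lemma action_isom: "\<lbrakk>(G, \<rho>) \<in> Ob D; \<gamma> \<in> carrier \<Gamma>\<rbrakk> \<Longrightarrow> isom C G G (\<rho> \<gamma>)"
  by (auto simp: Ob_D hom_def Aut_def)

lemma action_Hom: "\<lbrakk>(G, \<rho>) \<in> Ob D; \<gamma> \<in> carrier \<Gamma>\<rbrakk> \<Longrightarrow> \<rho> \<gamma> \<in> Hom C G G"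
  by (rule isom_Hom[OF action_isom])

lemma action_mult:
  "\<lbrakk>(G, \<rho>) \<in> Ob D; \<gamma> \<in> carrier \<Gamma>; \<delta> \<in> carrier \<Gamma>\<rbrakk> \<Longrightarrow> \<rho> (\<gamma> \<otimes>\<^bsub>\<Gamma>\<^esub> \<delta>) = Comp C (\<rho> \<gamma>) (\<rho> \<delta>)"
  by (auto simp: Ob_D hom_def Aut_def)

lemma action_one:
  assumes X: "(G, \<rho>) \<in> Ob D"
  shows "\<rho> \<one>\<^bsub>\<Gamma>\<^esub> = Ident C G"
proof -
  have G: "G \<in> Ob C" and i: "isom C G G (\<rho> \<one>\<^bsub>\<Gamma>\<^esub>)"
    using action_Ob[OF X] action_isom[OF X] by auto
  have "Comp C (\<rho> \<one>\<^bsub>\<Gamma>\<^esub>) (\<rho> \<one>\<^bsub>\<Gamma>\<^esub>) = Comp C (Ident C G) (\<rho> \<one>\<^bsub>\<Gamma>\<^esub>)"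
    using action_mult[OF X, of "\<one>\<^bsub>\<Gamma>\<^esub>" "\<one>\<^bsub>\<Gamma>\<^esub>"] Comp_Ident_left[OF G G isom_Hom[OF i]] by simp
  then show ?thesis
    using epi_cancel[OF isom_epi[OF G G i] G isom_Hom[OF i] Ident_closed[OF G]] by simp
qed

lemma action_inv:
  assumes X: "(G, \<rho>) \<in> Ob D" and \<gamma>: "\<gamma> \<in> carrier \<Gamma>"
  shows "Comp C (\<rho> \<gamma>) (\<rho> (inv\<^bsub>\<Gamma>\<^esub> \<gamma>)) = Ident C G" "Comp C (\<rho> (inv\<^bsub>\<Gamma>\<^esub> \<gamma>)) (\<rho> \<gamma>) = Ident C G"
  using action_mult[OF X \<gamma>, of "inv\<^bsub>\<Gamma>\<^esub> \<gamma>"] action_mult[OF X, of "inv\<^bsub>\<Gamma>\<^esub> \<gamma>" \<gamma>]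
    action_one[OF X] \<gamma> by auto

lemma small_category_D: "small_category D"
proof (unfold_locales, goal_cases)
  case (1 X Y Z f g)
  obtain G \<rho> where X: "X = (G, \<rho>)" by (cases X)
  obtain H \<sigma> where Y: "Y = (H, \<sigma>)" by (cases Y)
  obtain K \<tau> where Z: "Z = (K, \<tau>)" by (cases Z)
  note O = 1(1)[unfolded X] 1(2)[unfolded Y] 1(3)[unfolded Z]
  have f: "epi C G H f" and g: "epi C H K g" using 1 by (auto simp: X Y Z Hom_D)
  note GHK = action_Ob[OF O(1)] action_Ob[OF O(2)] action_Ob[OF O(3)]
  have "Comp C (Comp C g f) (\<rho> \<gamma>) = Comp C (\<tau> \<gamma>) (Comp C g f)" if \<gamma>: "\<gamma> \<in> carrier \<Gamma>" for \<gamma>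
  proof -
    note h = GHK epi_Hom[OF f] epi_Hom[OF g] action_Hom[OF O(1) \<gamma>] action_Hom[OF O(2) \<gamma>]
      action_Hom[OF O(3) \<gamma>]
    have "Comp C (Comp C g f) (\<rho> \<gamma>) = Comp C g (Comp C f (\<rho> \<gamma>))"
      using Comp_assoc[of G G H K "\<rho> \<gamma>" f g] h by simp
    also have "\<dots> = Comp C g (Comp C (\<sigma> \<gamma>) f)" using 1(4) \<gamma> by (simp add: X Y Hom_D)
    also have "\<dots> = Comp C (Comp C g (\<sigma> \<gamma>)) f"
      using Comp_assoc[of G H H K f "\<sigma> \<gamma>" g] h by simp
    also have "\<dots> = Comp C (Comp C (\<tau> \<gamma>) g) f" using 1(5) \<gamma> by (simp add: Y Z Hom_D)
    also have "\<dots> = Comp C (\<tau> \<gamma>) (Comp C g f)"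
      using Comp_assoc[of G H K K f g "\<tau> \<gamma>"] h by simp
    finally show ?thesis .
  qed
  then show ?case using epi_Comp[OF GHK f g] by (simp add: X Y Z Hom_D)
next
  case (2 X)
  obtain G \<rho> where X: "X = (G, \<rho>)" by (cases X)
  have O: "(G, \<rho>) \<in> Ob D" using 2 X by simp
  show ?case
    using isom_epi isom_Ident action_Ob[OF O] Comp_Ident_left[of G G] Comp_Ident_right[of G G] action_Hom[OF O]
    by (simp add: X Hom_D)
next
  case (3 X Y f)
  then show ?case
    by (cases X; cases Y) (auto simp: Hom_D Ob_D epi_Hom intro: Comp_Ident_right)
next
  case (4 X Y f)
  then show ?case
    by (cases X; cases Y) (auto simp: Hom_D Ob_D epi_Hom intro: Comp_Ident_left)
next
  case (5 W X Y Z f g h)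
  obtain A a where W: "W = (A, a)" by (cases W)
  obtain G \<rho> where X: "X = (G, \<rho>)" by (cases X)
  obtain H \<sigma> where Y: "Y = (H, \<sigma>)" by (cases Y)
  obtain K \<tau> where Z: "Z = (K, \<tau>)" by (cases Z)
  show ?case
    using 5 Comp_assoc[of A G H K f g h] by (simp add: W X Y Z Hom_D Ob_D epi_Hom)
qed

sublocale D: small_category D
  by (rule small_category_D)

text \<open>
  A morphism of \<open>D\<close> is an epimorphism of \<open>C\<close>, so it cancels all morphisms of \<open>C\<close>, those of \<open>D\<close> included.
\<close>

lemma epi_D:
  assumes "X \<in> Ob D" "Y \<in> Ob D"
  shows "epi D X Y f \<longleftrightarrow> f \<in> Hom D X Y"
proof
  assume f: "f \<in> Hom D X Y"
  show "epi D X Y f"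
    unfolding epi_def
  proof (intro conjI ballI impI f)
    fix Z p q assume *: "Z \<in> Ob D" "p \<in> Hom D Y Z" "q \<in> Hom D Y Z" "Comp D p f = Comp D q f"
    obtain G \<rho> H \<sigma> K \<tau> where "X = (G, \<rho>)" "Y = (H, \<sigma>)" "Z = (K, \<tau>)"
      by (cases X, cases Y, cases Z) blast
    then show "p = q"
      using * f epi_cancel[of G H f K p q] by (simp add: Hom_D Ob_D epi_Hom)
  qed
qed (rule D.epi_Hom)

lemma quotients_D:
  assumes "(G, \<rho>) \<in> Ob D"
  shows "((F, \<sigma>), \<pi>) \<in> quotients D (G, \<rho>) \<longleftrightarrow> (F, \<sigma>) \<in> Ob D \<and> epi C G F \<pi> \<and>
    (\<forall>\<gamma>\<in>carrier \<Gamma>. Comp C \<pi> (\<rho> \<gamma>) = Comp C (\<sigma> \<gamma>) \<pi>)"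
  using epi_D[OF assms] by (auto simp: D.quotients_iff Hom_D)

text \<open>
  The inverse of an equivariant isomorphism is equivariant: compare the two composites with \<open>\<sigma> \<gamma>\<close> and
  \<open>\<rho> \<gamma>\<close> after precomposition with \<open>f\<close>.
\<close>

lemma isom_D:
  assumes X: "(G, \<rho>) \<in> Ob D" and Y: "(H, \<sigma>) \<in> Ob D"
  shows "isom D (G, \<rho>) (H, \<sigma>) f \<longleftrightarrow>
    isom C G H f \<and> (\<forall>\<gamma>\<in>carrier \<Gamma>. Comp C f (\<rho> \<gamma>) = Comp C (\<sigma> \<gamma>) f)"
proof
  assume "isom D (G, \<rho>) (H, \<sigma>) f"
  then show "isom C G H f \<and> (\<forall>\<gamma>\<in>carrier \<Gamma>. Comp C f (\<rho> \<gamma>) = Comp C (\<sigma> \<gamma>) f)"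
    by (auto simp: isom_def Hom_D epi_Hom)
next
  assume f: "isom C G H f \<and> (\<forall>\<gamma>\<in>carrier \<Gamma>. Comp C f (\<rho> \<gamma>) = Comp C (\<sigma> \<gamma>) f)"
  then obtain g where g: "isom C H G g" "Comp C g f = Ident C G" "Comp C f g = Ident C H"
    using isom_inverse by metis
  note GH = action_Ob[OF X] action_Ob[OF Y]
  have "Comp C g (\<sigma> \<gamma>) = Comp C (\<rho> \<gamma>) g" if \<gamma>: "\<gamma> \<in> carrier \<Gamma>" for \<gamma>
  proof -
    note h = GH isom_Hom[OF g(1)] isom_Hom[of G H f] f action_Hom[OF X \<gamma>] action_Hom[OF Y \<gamma>]
    have "Comp C (Comp C g (\<sigma> \<gamma>)) f = Comp C g (Comp C f (\<rho> \<gamma>))"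
      using Comp_assoc[of G H H G f "\<sigma> \<gamma>" g] h \<gamma> by simp
    also have "\<dots> = \<rho> \<gamma>"
      using Comp_assoc[of G G H G "\<rho> \<gamma>" f g] Comp_Ident_left[of G G "\<rho> \<gamma>"] h g by simp
    also have "\<dots> = Comp C (Comp C (\<rho> \<gamma>) g) f"
      using Comp_assoc[of G H G G f g "\<rho> \<gamma>"] Comp_Ident_right[of G G "\<rho> \<gamma>"] h g by simp
    finally show ?thesis
      using epi_cancel[OF isom_epi[OF GH, of f], of G "Comp C g (\<sigma> \<gamma>)" "Comp C (\<rho> \<gamma>) g"] h
        Comp_closed[of H H G "\<sigma> \<gamma>" g] Comp_closed[of H G G g "\<rho> \<gamma>"] by simp
  qed
  then show "isom D (G, \<rho>) (H, \<sigma>) f"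
    using f g isom_epi GH unfolding isom_def[of D] by (auto simp: Hom_D)
qed

text \<open>
  Each \<open>s\<close> is determined by \<open>\<gamma>\<close> because \<open>\<pi>\<close> is an epimorphism, and for the same reason the
  choice is multiplicative in \<open>\<gamma>\<close>. So it is enough that every group element separately descends to \<open>F\<close>.
\<close>

lemma induced_action:
  assumes X: "(G, \<rho>) \<in> Ob D" and F: "F \<in> Ob C" and \<pi>: "epi C G F \<pi>"
    and ex: "\<And>\<gamma>. \<gamma> \<in> carrier \<Gamma> \<Longrightarrow> \<exists>s. isom C F F s \<and> Comp C \<pi> (\<rho> \<gamma>) = Comp C s \<pi>"
  obtains \<sigma> where "(F, \<sigma>) \<in> Ob D" "((F, \<sigma>), \<pi>) \<in> quotients D (G, \<rho>)"
proof -
  obtain s where s: "\<And>\<gamma>. \<gamma> \<in> carrier \<Gamma> \<Longrightarrow> isom C F F (s \<gamma>)"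
    "\<And>\<gamma>. \<gamma> \<in> carrier \<Gamma> \<Longrightarrow> Comp C \<pi> (\<rho> \<gamma>) = Comp C (s \<gamma>) \<pi>"
    using ex by metis
  define \<sigma> where "\<sigma> = restrict s (carrier \<Gamma>)"
  have G: "G \<in> Ob C" using X by (rule action_Ob)
  have mult: "s (\<gamma> \<otimes>\<^bsub>\<Gamma>\<^esub> \<delta>) = Comp C (s \<gamma>) (s \<delta>)" if "\<gamma> \<in> carrier \<Gamma>" "\<delta> \<in> carrier \<Gamma>" for \<gamma> \<delta>
  proof -
    have \<gamma>\<delta>: "\<gamma> \<otimes>\<^bsub>\<Gamma>\<^esub> \<delta> \<in> carrier \<Gamma>" using that by simp
    note h = G F epi_Hom[OF \<pi>] that action_Hom[OF X that(1)] action_Hom[OF X that(2)]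
      isom_Hom[OF s(1)[OF that(1)]] isom_Hom[OF s(1)[OF that(2)]] isom_Hom[OF s(1)[OF \<gamma>\<delta>]]
    have "Comp C (s (\<gamma> \<otimes>\<^bsub>\<Gamma>\<^esub> \<delta>)) \<pi> = Comp C \<pi> (Comp C (\<rho> \<gamma>) (\<rho> \<delta>))"
      using s(2)[OF \<gamma>\<delta>] action_mult[OF X that] by simp
    also have "\<dots> = Comp C (Comp C (s \<gamma>) \<pi>) (\<rho> \<delta>)"
      using Comp_assoc[of G G G F "\<rho> \<delta>" "\<rho> \<gamma>" \<pi>] s(2)[OF that(1)] h by simp
    also have "\<dots> = Comp C (s \<gamma>) (Comp C (s \<delta>) \<pi>)"
      using Comp_assoc[of G G F F "\<rho> \<delta>" \<pi> "s \<gamma>"] s(2)[OF that(2)] h by simp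
    also have "\<dots> = Comp C (Comp C (s \<gamma>) (s \<delta>)) \<pi>"
      using Comp_assoc[of G F F F \<pi> "s \<delta>" "s \<gamma>"] h by simp
    finally show ?thesis
      using epi_cancel[OF \<pi> F] h Comp_closed[of F F F "s \<delta>" "s \<gamma>"] by simp
  qed
  have "\<sigma> \<in> hom \<Gamma> (Aut C F)"
    by (rule homI) (use s(1) mult in \<open>auto simp: \<sigma>_def Aut_def\<close>)
  then have "(F, \<sigma>) \<in> Ob D" using F by (simp add: Ob_D \<sigma>_def)
  moreover from this have "((F, \<sigma>), \<pi>) \<in> quotients D (G, \<rho>)"
    using s(2) \<pi> by (auto simp: quotients_D[OF X] \<sigma>_def)
  ultimately show ?thesis by (rule that)
qed

lemma transport_action:
  assumes X: "(F, \<sigma>) \<in> Ob D" and F': "F' \<in> Ob C" and r: "isom C F F' r"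
  obtains \<sigma>' where "(F', \<sigma>') \<in> Ob D" "isom D (F, \<sigma>) (F', \<sigma>') r"
proof -
  have F: "F \<in> Ob C" using X by (rule action_Ob)
  obtain r' where r': "isom C F' F r'" "Comp C r' r = Ident C F" using r isom_inverse by metis
  have ex: "\<exists>s. isom C F' F' s \<and> Comp C r (\<sigma> \<gamma>) = Comp C s r" if \<gamma>: "\<gamma> \<in> carrier \<Gamma>" for \<gamma>
  proof (intro exI conjI)
    let ?s = "Comp C (Comp C r (\<sigma> \<gamma>)) r'"
    have a: "isom C F F' (Comp C r (\<sigma> \<gamma>))"
      by (rule isom_Comp[OF F F F' action_isom[OF X \<gamma>] r])
    show "isom C F' F' ?s" by (rule isom_Comp[OF F' F F' r'(1) a])
    show "Comp C r (\<sigma> \<gamma>) = Comp C ?s r"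
      using Comp_assoc[of F F' F F' r r' "Comp C r (\<sigma> \<gamma>)"] r' isom_Hom[OF r] isom_Hom[OF r'(1)]
        isom_Hom[OF a] Comp_Ident_right[OF F F' isom_Hom[OF a]] F F' by simp
  qed
  obtain \<sigma>' where \<sigma>': "(F', \<sigma>') \<in> Ob D" "((F', \<sigma>'), r) \<in> quotients D (F, \<sigma>)"
    using induced_action[OF X F' isom_epi[OF F F' r] ex] by blast
  then have "isom D (F, \<sigma>) (F', \<sigma>') r"
    using r by (simp add: isom_D[OF X \<sigma>'(1)] quotients_D[OF X])
  with \<sigma>'(1) show ?thesis by (rule that)
qed

section \<open>Quotients of an equivariant object are the invariant quotients\<close>

text \<open>
  Forgetting the action on each member of a class yields a full class of quotients in \<open>C\<close>
  (\<open>forget_quot_class\<close>), because actions can be transported along isomorphisms.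
\<close>

definition forget :: "(('o \<times> ('g \<Rightarrow> 'm)) \<times> 'm) set \<Rightarrow> ('o \<times> 'm) set" where
  "forget P = map_prod fst id ` P"

lemma forget_quot_class:
  assumes X: "(G, \<rho>) \<in> Ob D" and F: "((F, \<sigma>), \<pi>) \<in> quotients D (G, \<rho>)"
  shows "forget (quot_class D (G, \<rho>) (F, \<sigma>) \<pi>) = quot_class C G F \<pi>"
proof (intro equalityI subsetI)
  have G: "G \<in> Ob C" using X by (rule action_Ob)
  have FD: "(F, \<sigma>) \<in> Ob D" and q: "(F, \<pi>) \<in> quotients C G"
    using F by (auto simp: quotients_D[OF X] quotients_iff action_Ob)
  fix x
  show "x \<in> quot_class C G F \<pi>" if x: "x \<in> forget (quot_class D (G, \<rho>) (F, \<sigma>) \<pi>)"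
  proof -
    obtain F' \<sigma>' \<pi>' where x': "x = (F', \<pi>')" "((F', \<sigma>'), \<pi>') \<in> quot_class D (G, \<rho>) (F, \<sigma>) \<pi>"
      using x by (auto simp: forget_def)
    then obtain r where r: "((F', \<sigma>'), \<pi>') \<in> quotients D (G, \<rho>)"
      "isom D (F, \<sigma>) (F', \<sigma>') r" "\<pi>' = Comp C r \<pi>"
      by (auto simp: D.mem_quot_class_iff)
    then show ?thesis
      using q x'(1) isom_D[OF FD] by (auto simp: mem_quot_class_iff quotients_D[OF X] quotients_iff action_Ob)
  qed
  show "x \<in> forget (quot_class D (G, \<rho>) (F, \<sigma>) \<pi>)" if x: "x \<in> quot_class C G F \<pi>"
  proof -
    obtain F' \<pi>' r where x': "x = (F', \<pi>')" "F' \<in> Ob C" "isom C F F' r" "\<pi>' = Comp C r \<pi>"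
      using x by (cases x) (auto simp: mem_quot_class_iff quotients_iff)
    obtain \<sigma>' where \<sigma>': "(F', \<sigma>') \<in> Ob D" "isom D (F, \<sigma>) (F', \<sigma>') r"
      using transport_action[OF FD x'(2,3)] by blast
    have "((F', \<sigma>'), \<pi>') \<in> quotients D (G, \<rho>)"
      using D.epi_Comp[OF X FD \<sigma>'(1), of \<pi> r] D.isom_epi[OF FD \<sigma>'] F \<sigma>'(1) x'(4)
      by (simp add: D.quotients_iff)
    then have "((F', \<sigma>'), \<pi>') \<in> quot_class D (G, \<rho>) (F, \<sigma>) \<pi>"
      using F \<sigma>'(2) x'(4) by (auto simp: D.mem_quot_class_iff)
    then have "map_prod fst id ((F', \<sigma>'), \<pi>') \<in> forget (quot_class D (G, \<rho>) (F, \<sigma>) \<pi>)"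
      unfolding forget_def by (rule imageI)
    then show ?thesis using x'(1) by simp
  qed
qed

lemma quot_poset_D_cases:
  assumes "(G, \<rho>) \<in> Ob D" "P \<in> carrier (quot_poset D (G, \<rho>))"
  obtains F \<sigma> \<pi> where "((F, \<sigma>), \<pi>) \<in> quotients D (G, \<rho>)" "(F, \<sigma>) \<in> Ob D" "(F, \<pi>) \<in> quotients C G"
    "P = quot_class D (G, \<rho>) (F, \<sigma>) \<pi>" "forget P = quot_class C G F \<pi>"
  using assms(2)
proof (cases rule: D.quot_poset_cases)
  case (1 X \<pi>)
  obtain F \<sigma> where X: "X = (F, \<sigma>)" by (cases X)
  have q: "((F, \<sigma>), \<pi>) \<in> quotients D (G, \<rho>)" using 1(1) X by simp
  show ?thesis
    using that[OF q] q 1(2) forget_quot_class[OF assms(1) q] X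
    by (simp add: quotients_D[OF assms(1)] quotients_iff action_Ob)
qed

lemma forget_closed:
  "\<lbrakk>(G, \<rho>) \<in> Ob D; P \<in> carrier (quot_poset D (G, \<rho>))\<rbrakk> \<Longrightarrow> forget P \<in> carrier (quot_poset C G)"
  by (metis quot_poset_D_cases quot_class_carrier)

text \<open>
  A factorization \<open>\<pi> = h \<eta>\<close> in \<open>C\<close> is automatically equivariant: the two sides of the equation for \<open>h\<close>
  agree after composition with the epimorphism \<open>\<eta>\<close>.
\<close>

lemma forget_le_iff:
  assumes X: "(G, \<rho>) \<in> Ob D"
    and P: "P \<in> carrier (quot_poset D (G, \<rho>))" and Q: "Q \<in> carrier (quot_poset D (G, \<rho>))"
  shows "P \<sqsubseteq>\<^bsub>quot_poset D (G, \<rho>)\<^esub> Q \<longleftrightarrow> forget P \<sqsubseteq>\<^bsub>quot_poset C G\<^esub> forget Q"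
proof -
  obtain F \<sigma> \<pi> where F: "((F, \<sigma>), \<pi>) \<in> quotients D (G, \<rho>)" "(F, \<sigma>) \<in> Ob D" "(F, \<pi>) \<in> quotients C G"
    "P = quot_class D (G, \<rho>) (F, \<sigma>) \<pi>" "forget P = quot_class C G F \<pi>"
    using quot_poset_D_cases[OF X P] .
  obtain H \<tau> \<eta> where H: "((H, \<tau>), \<eta>) \<in> quotients D (G, \<rho>)" "(H, \<tau>) \<in> Ob D" "(H, \<eta>) \<in> quotients C G"
    "Q = quot_class D (G, \<rho>) (H, \<tau>) \<eta>" "forget Q = quot_class C G H \<eta>"
    using quot_poset_D_cases[OF X Q] .
  have O: "G \<in> Ob C" "F \<in> Ob C" "H \<in> Ob C" using X F(2) H(2) by (auto simp: action_Ob)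
  have e: "epi C G F \<pi>" "epi C G H \<eta>" using F(3) H(3) by (auto simp: quotients_iff)
  have "(\<exists>h\<in>Hom D (H, \<tau>) (F, \<sigma>). \<pi> = Comp C h \<eta>) \<longleftrightarrow> (\<exists>h\<in>Hom C H F. \<pi> = Comp C h \<eta>)"
  proof
    assume "\<exists>h\<in>Hom C H F. \<pi> = Comp C h \<eta>"
    then obtain h where h: "h \<in> Hom C H F" "\<pi> = Comp C h \<eta>" by blast
    have eh: "epi C H F h"
      using epi_of_epi_Comp[OF O(1,3,2) epi_Hom[OF e(2)] h(1)] e(1) h(2) by simp
    have "Comp C h (\<tau> \<gamma>) = Comp C (\<sigma> \<gamma>) h" if \<gamma>: "\<gamma> \<in> carrier \<Gamma>" for \<gamma>
    proof -
      note m = O h(1) epi_Hom[OF e(2)] action_Hom[OF X \<gamma>] action_Hom[OF F(2) \<gamma>] action_Hom[OF H(2) \<gamma>]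
      have eq: "Comp C \<pi> (\<rho> \<gamma>) = Comp C (\<sigma> \<gamma>) \<pi>" "Comp C \<eta> (\<rho> \<gamma>) = Comp C (\<tau> \<gamma>) \<eta>"
        using F(1) H(1) \<gamma> by (auto simp: quotients_D[OF X])
      have "Comp C (Comp C h (\<tau> \<gamma>)) \<eta> = Comp C h (Comp C \<eta> (\<rho> \<gamma>))"
        using Comp_assoc[of G H H F \<eta> "\<tau> \<gamma>" h] m eq(2) by simp
      also have "\<dots> = Comp C (\<sigma> \<gamma>) (Comp C h \<eta>)"
        using Comp_assoc[of G G H F "\<rho> \<gamma>" \<eta> h] m eq(1) h(2) by simp
      also have "\<dots> = Comp C (Comp C (\<sigma> \<gamma>) h) \<eta>"
        using Comp_assoc[of G H F F \<eta> h "\<sigma> \<gamma>"] m by simp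
      finally show ?thesis
        using epi_cancel[OF e(2) O(2)] m Comp_closed[of H H F "\<tau> \<gamma>" h] Comp_closed[of H F F h "\<sigma> \<gamma>"]
        by simp
    qed
    then show "\<exists>h\<in>Hom D (H, \<tau>) (F, \<sigma>). \<pi> = Comp C h \<eta>"
      using eh h(2) by (auto simp: Hom_D)
  qed (auto simp: Hom_D epi_Hom)
  then show ?thesis
    using D.quot_le_iff[OF X F(1) H(1)] quot_le_iff[OF O(1) F(3) H(3)]
    unfolding F(5) H(5) by (simp add: F(4) H(4))
qed

lemma forget_inj:
  assumes X: "(G, \<rho>) \<in> Ob D"
  shows "inj_on forget (carrier (quot_poset D (G, \<rho>)))"
proof (rule inj_onI)
  interpret QD: partial_order "quot_poset D (G, \<rho>)" by (rule D.quot_poset_partial_order[OF X])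
  interpret QC: partial_order "quot_poset C G" by (rule quot_poset_partial_order[OF action_Ob[OF X]])
  fix P Q assume *: "P \<in> carrier (quot_poset D (G, \<rho>))" "Q \<in> carrier (quot_poset D (G, \<rho>))"
    "forget P = forget Q"
  then have "P \<sqsubseteq>\<^bsub>quot_poset D (G, \<rho>)\<^esub> Q" "Q \<sqsubseteq>\<^bsub>quot_poset D (G, \<rho>)\<^esub> P"
    using forget_le_iff[OF X] forget_closed[OF X] QC.le_refl by auto
  then show "P = Q" using QD.le_antisym * by blast
qed

lemma action_order_automorphism:
  assumes X: "(G, \<rho>) \<in> Ob D" and \<gamma>: "\<gamma> \<in> carrier \<Gamma>"
  shows "order_automorphism (quot_poset C G) (twist (\<rho> \<gamma>)) (twist (\<rho> (inv\<^bsub>\<Gamma>\<^esub> \<gamma>)))"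
  by (rule twist_order_automorphism)
    (use action_Ob[OF X] action_isom[OF X] action_inv[OF X] \<gamma> in auto)

text \<open>
  That the class of \<open>\<pi> : G \<rightarrow> F\<close> is fixed by \<open>\<rho> \<gamma>\<close> says that \<open>\<pi> \<rho>(\<gamma>) = s \<pi>\<close> for an automorphism \<open>s\<close> of
  \<open>F\<close>, which is the condition under which \<open>F\<close> inherits an action.
\<close>

lemma forget_image_eq_invariants:
  assumes X: "(G, \<rho>) \<in> Ob D"
  shows "forget ` carrier (quot_poset D (G, \<rho>)) =
    {Q \<in> carrier (quot_poset C G). \<forall>\<gamma>\<in>carrier \<Gamma>. twist (\<rho> \<gamma>) Q = Q}"
proof (intro equalityI subsetI)
  have G: "G \<in> Ob C" using X by (rule action_Ob)
  fix Q
  show "Q \<in> {Q \<in> carrier (quot_poset C G). \<forall>\<gamma>\<in>carrier \<Gamma>. twist (\<rho> \<gamma>) Q = Q}"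
    if Q: "Q \<in> forget ` carrier (quot_poset D (G, \<rho>))"
  proof -
    obtain P where "P \<in> carrier (quot_poset D (G, \<rho>))" "Q = forget P" using Q by blast
    then obtain F \<sigma> \<pi> where F: "((F, \<sigma>), \<pi>) \<in> quotients D (G, \<rho>)" "(F, \<sigma>) \<in> Ob D"
      "(F, \<pi>) \<in> quotients C G" "Q = quot_class C G F \<pi>"
      using quot_poset_D_cases[OF X] by metis
    have "twist (\<rho> \<gamma>) Q = Q" if \<gamma>: "\<gamma> \<in> carrier \<Gamma>" for \<gamma>
    proof -
      note a = action_isom[OF X \<gamma>]
      have "quot_class C G F \<pi> = quot_class C G F (Comp C \<pi> (\<rho> \<gamma>))"
        using quot_class_eq_iff[OF G F(3) twist_quotient[OF G a F(3)]] action_isom[OF F(2) \<gamma>] F(1) \<gamma>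
        by (auto simp: quotients_D[OF X])
      then show ?thesis using twist_quot_class[OF G a F(3)] F(4) by simp
    qed
    then show ?thesis using F(4) quot_class_carrier[OF F(3)] by simp
  qed
  show "Q \<in> forget ` carrier (quot_poset D (G, \<rho>))"
    if Q: "Q \<in> {Q \<in> carrier (quot_poset C G). \<forall>\<gamma>\<in>carrier \<Gamma>. twist (\<rho> \<gamma>) Q = Q}"
  proof -
    obtain F \<pi> where F: "(F, \<pi>) \<in> quotients C G" "Q = quot_class C G F \<pi>"
      using Q quot_poset_cases by blast
    have ex: "\<exists>s. isom C F F s \<and> Comp C \<pi> (\<rho> \<gamma>) = Comp C s \<pi>" if \<gamma>: "\<gamma> \<in> carrier \<Gamma>" for \<gamma>
    proof -
      note a = action_isom[OF X \<gamma>]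
      have "quot_class C G F \<pi> = quot_class C G F (Comp C \<pi> (\<rho> \<gamma>))"
        using twist_quot_class[OF G a F(1)] Q F(2) \<gamma> by simp
      then show ?thesis
        using quot_class_eq_iff[OF G F(1) twist_quotient[OF G a F(1)]] by simp
    qed
    have "F \<in> Ob C" "epi C G F \<pi>" using F(1) by (auto simp: quotients_iff)
    then obtain \<sigma> where \<sigma>: "((F, \<sigma>), \<pi>) \<in> quotients D (G, \<rho>)"
      using induced_action[OF X _ _ ex] by blast
    then show ?thesis
      using forget_quot_class[OF X \<sigma>] F(2) D.quot_class_carrier[OF \<sigma>] by (metis imageI)
  qed
qed

text \<open>
  A join or meet of two classes fixed by \<open>\<Gamma>\<close> is fixed by \<open>\<Gamma>\<close>, hence comes from \<open>D\<close>.
\<close>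

lemma forget_modular_embedding:
  assumes X: "(G, \<rho>) \<in> Ob D"
  shows "modular_embedding (quot_poset C G) (quot_poset D (G, \<rho>)) forget"
proof -
  interpret Q: modular_lattice "quot_poset C G" by (rule modular_quotients[OF action_Ob[OF X]])
  have inv: "twist (\<rho> \<gamma>) (forget P) = forget P"
    if "P \<in> carrier (quot_poset D (G, \<rho>))" "\<gamma> \<in> carrier \<Gamma>" for P \<gamma>
    using forget_image_eq_invariants[OF X] that by blast
  show ?thesis
  proof unfold_locales
    fix x y assume x: "x \<in> carrier (quot_poset D (G, \<rho>))" and y: "y \<in> carrier (quot_poset D (G, \<rho>))"
    note xy = forget_closed[OF X x] forget_closed[OF X y]
    show "forget x \<squnion>\<^bsub>quot_poset C G\<^esub> forget y \<in> forget ` carrier (quot_poset D (G, \<rho>))"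
      unfolding forget_image_eq_invariants[OF X] join_def mem_Collect_eq
      using order_automorphism.lub_fixed[OF action_order_automorphism[OF X] Q.sup_of_two_least[OF xy]]
        inv[OF x] inv[OF y] xy Q.join_closed[OF xy] by (auto simp: join_def)
    show "forget x \<sqinter>\<^bsub>quot_poset C G\<^esub> forget y \<in> forget ` carrier (quot_poset D (G, \<rho>))"
      unfolding forget_image_eq_invariants[OF X] meet_def mem_Collect_eq
      using order_automorphism.glb_fixed[OF action_order_automorphism[OF X] Q.inf_of_two_greatest[OF xy]]
        inv[OF x] inv[OF y] xy Q.meet_closed[OF xy] by (auto simp: meet_def)
    show "x \<sqsubseteq>\<^bsub>quot_poset D (G, \<rho>)\<^esub> y \<longleftrightarrow> forget x \<sqsubseteq>\<^bsub>quot_poset C G\<^esub> forget y"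
      by (rule forget_le_iff[OF X x y])
  qed (use forget_closed[OF X] forget_inj[OF X] in \<open>auto simp: quot_poset_def\<close>)
qed


lemma finite_quotients_D:
  assumes X: "(G, \<rho>) \<in> Ob D"
  shows "finite (carrier (quot_poset D (G, \<rho>)))"
  using inj_on_finite[OF forget_inj[OF X]] forget_closed[OF X] finite_quotients[OF action_Ob[OF X]]
  by blast

lemma finite_Aut_D:
  assumes X: "(G, \<rho>) \<in> Ob D"
  shows "finite (carrier (Aut D (G, \<rho>)))"
  by (rule finite_subset[OF _ finite_Aut[OF action_Ob[OF X]]]) (auto simp: Aut_def isom_D[OF X X])

lemma forget_Ident:
  assumes X: "(G, \<rho>) \<in> Ob D"
  shows "forget (quot_class D (G, \<rho>) (G, \<rho>) (Ident D (G, \<rho>))) = quot_class C G G (Ident C G)"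
  using forget_quot_class[OF X D.Ident_quotient[OF X]] by simp

section \<open>Minimal objects and levels\<close>

text \<open>
  The least quotient \<open>b\<close> of \<open>G\<close> is fixed by every automorphism, so it is a quotient in \<open>D\<close>. By
  minimality it is \<open>G\<close> itself, so the least and the greatest quotient of \<open>G\<close> coincide.
\<close>

lemma minimal_object_underlying:
  assumes min: "minimal_object D (G, \<rho>)"
  shows "minimal_object C G"
proof -
  have X: "(G, \<rho>) \<in> Ob D"
    and one: "carrier (quot_poset D (G, \<rho>)) = {quot_class D (G, \<rho>) (G, \<rho>) (Ident D (G, \<rho>))}"
    using min by (auto simp: minimal_object_def)
  have G: "G \<in> Ob C" using X by (rule action_Ob)
  let ?Q = "quot_poset C G"
  interpret Q: modular_lattice ?Q by (rule modular_quotients[OF G])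
  let ?top = "quot_class C G G (Ident C G)"
  have top: "?top \<in> carrier ?Q" by (rule quot_class_carrier[OF Ident_quotient[OF G]])
  obtain b where b: "greatest ?Q b (Lower ?Q (carrier ?Q))"
    using Q.finite_inf_greatest[OF finite_quotients[OF G] subset_refl] top by blast
  have bc: "b \<in> carrier ?Q" using b by auto
  have "twist (\<rho> \<gamma>) b = b" if \<gamma>: "\<gamma> \<in> carrier \<Gamma>" for \<gamma>
  proof -
    interpret order_automorphism ?Q "twist (\<rho> \<gamma>)" "twist (\<rho> (inv\<^bsub>\<Gamma>\<^esub> \<gamma>))"
      by (rule action_order_automorphism[OF X \<gamma>])
    have "twist (\<rho> \<gamma>) ` carrier ?Q = carrier ?Q"
      using t_closed s_closed t_s by (metis image_eqI subsetI subset_antisym image_subsetI)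
    then show ?thesis using glb_fixed[OF b] by simp
  qed
  then have "b \<in> forget ` carrier (quot_poset D (G, \<rho>))"
    using forget_image_eq_invariants[OF X] bc by blast
  then have "b = ?top" using one forget_Ident[OF X] by simp
  then have "P = ?top" if P: "P \<in> carrier ?Q" for P
    using quot_class_Ident_greatest[OF G P] greatest_Lower_below[OF b P subset_refl] P top Q.le_antisym
    by blast
  then have "carrier ?Q = {?top}" using top by blast
  then show ?thesis using G by (simp add: minimal_object_def)
qed

lemma quotient_underlying:
  "\<lbrakk>(G, \<rho>) \<in> Ob D; ((F, \<sigma>), \<pi>) \<in> quotients D (G, \<rho>)\<rbrakk> \<Longrightarrow> (F, \<pi>) \<in> quotients C G"
  by (auto simp: quotients_D quotients_iff dest: action_Ob)

text \<open>
  Let \<open>L'\<close> be the level of \<open>C\<close> generated by the isomorphism classes of the objects underlying the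
  generators of \<open>L\<close>. The objects of \<open>D\<close> over \<open>L'\<close> satisfy all closure conditions defining \<open>L\<close>: joins in
  \<open>D\<close> are joins in \<open>C\<close>, and minimal objects of \<open>D\<close> lie over minimal objects of \<open>C\<close>.
\<close>

lemma level_lies_over_level:
  assumes L: "is_level D L"
  obtains L' where "is_level C L'" "fst ` L \<subseteq> L'"
proof -
  obtain B where B: "finite B" "B \<subseteq> iso_classes D" "L = generated_level D B"
    using L by (auto simp: is_level_def)
  define B' where "B' = (\<lambda>K. iso_rel C `` (fst ` K)) ` B"
  have iso_rel_trans: "(X, Z) \<in> iso_rel C" if "(X, Y) \<in> iso_rel C" "(Y, Z) \<in> iso_rel C" for X Y Z
    using equiv_iso_rel that by (meson equivE transD)
  have cls: "iso_rel C `` (fst ` K) \<in> iso_classes C" "fst ` K \<subseteq> iso_rel C `` (fst ` K)"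
    if K: "K \<in> iso_classes D" for K
  proof -
    obtain G \<rho> where X: "(G, \<rho>) \<in> Ob D" "K = iso_rel D `` {(G, \<rho>)}"
      using K by (auto simp: iso_classes_def elim!: quotientE)
    have G: "G \<in> Ob C" using X(1) by (rule action_Ob)
    have iso: "(G, H) \<in> iso_rel C" if "(H, \<sigma>) \<in> K" for H \<sigma>
      using that X isom_D[OF X(1)] by (auto simp: iso_rel_def action_Ob)
    have "(G, \<rho>) \<in> K" using equiv_class_self[OF D.equiv_iso_rel X(1)] X(2) by simp
    then have GK: "G \<in> fst ` K" by force
    have fst_K: "fst ` K \<subseteq> iso_rel C `` {G}" using iso by auto
    have "iso_rel C `` (fst ` K) = iso_rel C `` {G}"
    proof
      show "iso_rel C `` (fst ` K) \<subseteq> iso_rel C `` {G}"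
        using fst_K iso_rel_trans by blast
      show "iso_rel C `` {G} \<subseteq> iso_rel C `` (fst ` K)" using GK by blast
    qed
    with fst_K G show "iso_rel C `` (fst ` K) \<in> iso_classes C" "fst ` K \<subseteq> iso_rel C `` (fst ` K)"
      by (auto simp: iso_classes_def quotientI)
  qed
  define L' where "L' = generated_level C B'"
  have L': "is_level C L'"
    unfolding is_level_def L'_def using B cls(1) by (intro exI[of _ B']) (auto simp: B'_def)
  define S where "S = {X \<in> Ob D. fst X \<in> L'}"
  have B'L': "\<Union>B' \<subseteq> L'" and minL': "{G. minimal_object C G} \<subseteq> L'"
    unfolding L'_def generated_level_def by blast+
  have "L \<subseteq> S"
    unfolding B(3) generated_level_def
  proof (rule Inter_lower, rule CollectI, intro conjI)
    show "iso_stable D S"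
      unfolding iso_stable_def
    proof (intro conjI ballI allI impI)
      fix X Y assume "X \<in> S" "(X, Y) \<in> iso_rel D"
      moreover obtain G \<rho> H \<sigma> where "X = (G, \<rho>)" "Y = (H, \<sigma>)" by (cases X, cases Y) blast
      ultimately have "(G, H) \<in> iso_rel C" "G \<in> L'" "Y \<in> Ob D" "fst Y = H"
        using isom_D by (auto simp: iso_rel_def S_def action_Ob)
      then show "Y \<in> S" using level_iso_stable[OF L'] by (auto simp: S_def iso_stable_def)
    qed (auto simp: S_def)
    show "downward_closed D S"
      unfolding downward_closed_def
    proof clarify
      fix G \<rho> F \<sigma> \<pi> assume *: "(G, \<rho>) \<in> S" "((F, \<sigma>), \<pi>) \<in> quotients D (G, \<rho>)"
      then have X: "(G, \<rho>) \<in> Ob D" and "G \<in> L'" by (auto simp: S_def)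
      then have "F \<in> L'"
        using level_downward_closed[OF L'] quotient_underlying[OF X *(2)]
        unfolding downward_closed_def by blast
      then show "(F, \<sigma>) \<in> S" using *(2) by (simp add: S_def quotients_D[OF X])
    qed
    show "join_closed D S"
      unfolding join_closed_def
    proof clarify
      fix G \<rho> H \<tau> \<eta> F \<sigma> \<pi> J \<upsilon> \<theta>
      assume X: "(G, \<rho>) \<in> Ob D" and H: "((H, \<tau>), \<eta>) \<in> quotients D (G, \<rho>)"
        and F: "((F, \<sigma>), \<pi>) \<in> quotients D (G, \<rho>)" and J: "((J, \<upsilon>), \<theta>) \<in> quotients D (G, \<rho>)"
        and S: "(H, \<tau>) \<in> S" "(F, \<sigma>) \<in> S"
        and lub: "is_lub (quot_poset D (G, \<rho>)) (quot_class D (G, \<rho>) (J, \<upsilon>) \<theta>)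
          {quot_class D (G, \<rho>) (H, \<tau>) \<eta>, quot_class D (G, \<rho>) (F, \<sigma>) \<pi>}"
      have G: "G \<in> Ob C" using X by (rule action_Ob)
      interpret E: modular_embedding "quot_poset C G" "quot_poset D (G, \<rho>)" forget
        by (rule forget_modular_embedding[OF X])
      have q: "(H, \<eta>) \<in> quotients C G" "(F, \<pi>) \<in> quotients C G" "(J, \<theta>) \<in> quotients C G"
        using H F J by (auto intro: quotient_underlying[OF X])
      have "quot_class C G J \<theta> = quot_class C G H \<eta> \<squnion>\<^bsub>quot_poset C G\<^esub> quot_class C G F \<pi>"
        using E.lub_image[OF D.quot_class_carrier[OF H] D.quot_class_carrier[OF F] lub]
        by (simp add: forget_quot_class[OF X] H F J)
      then have "is_lub (quot_poset C G) (quot_class C G J \<theta>)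
          {quot_class C G H \<eta>, quot_class C G F \<pi>}"
        using E.L.sup_of_two_least[OF quot_class_carrier[OF q(1)] quot_class_carrier[OF q(2)]]
        by (simp add: join_def)
      then have "J \<in> L'"
        using join_closedD[OF level_join_closed[OF L'] G q] S by (simp add: S_def)
      then show "(J, \<upsilon>) \<in> S" using J by (simp add: S_def quotients_D[OF X])
    qed
    show "\<Union>B \<subseteq> S"
    proof
      fix X assume "X \<in> \<Union>B"
      then obtain K where K: "X \<in> K" "K \<in> B" by blast
      then have "fst X \<in> \<Union>B'" using cls(2)[of K] B(2) by (auto simp: B'_def)
      then show "X \<in> S" using K B(2) D.iso_class_subset_Ob[of K] B'L' by (auto simp: S_def)
    qed
    show "{G. minimal_object D G} \<subseteq> S"
      using minimal_object_underlying minL' by (auto simp: S_def minimal_object_def)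
  qed
  then have "fst ` L \<subseteq> L'" by (auto simp: S_def)
  with L' show ?thesis by (rule that)
qed

section \<open>Simple equivariant epimorphisms\<close>

text \<open>
  Let \<open>k\<close> be a quotient of \<open>H\<close> covering \<open>G\<close>. All its translates cover \<open>G\<close>, since \<open>G\<close> is invariant. Their
  join is invariant, so it belongs to the interval \<open>[G, H]\<close> of \<open>D\<close>; it is not \<open>G\<close>, so it is \<open>H\<close>.
\<close>

lemma simple_epi_D_underlying_tower:
  assumes Y: "(H, \<tau>) \<in> Ob D" and X: "(G, \<rho>) \<in> Ob D" and s: "simple_epi D (H, \<tau>) (G, \<rho>) \<pi>"
    and L: "downward_closed C L" and HL: "H \<in> L"
  shows "\<exists>X\<in>simple_towers C L G (card (carrier \<Gamma>)). (H, X) \<in> iso_rel C"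
proof -
  have H: "H \<in> Ob C" using Y by (rule action_Ob)
  let ?Q = "quot_poset C H"
  interpret Q: modular_lattice ?Q by (rule modular_quotients[OF H])
  let ?g = "quot_class C H G \<pi>" and ?top = "quot_class C H H (Ident C H)"
  have qD: "((G, \<rho>), \<pi>) \<in> quotients D (H, \<tau>)"
    using s X by (simp add: simple_epi_def D.quotients_iff)
  then have q: "(G, \<pi>) \<in> quotients C H"
    by (rule quotient_underlying[OF Y])
  have g: "?g \<in> carrier ?Q" using q by (rule quot_class_carrier)
  have fg: "forget (quot_class D (H, \<tau>) (G, \<rho>) \<pi>) = ?g" by (rule forget_quot_class[OF Y qD])
  have "\<not> isom C H G \<pi>"
    using s qD by (simp add: simple_epi_def isom_D[OF Y X] quotients_D[OF Y])
  then have "?g \<noteq> ?top" using quot_class_eq_Ident_iff[OF H q] by simp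
  then obtain k where k: "covers ?Q ?g k"
    using Q.exists_cover_above[OF finite_quotients[OF H] g quot_class_carrier[OF Ident_quotient[OF H]]]
      quot_class_Ident_greatest[OF H g] by blast
  have kc: "k \<in> carrier ?Q" using k by (simp add: covers_def)
  have tg: "twist (\<tau> \<gamma>) ?g = ?g" if "\<gamma> \<in> carrier \<Gamma>" for \<gamma>
    using forget_image_eq_invariants[OF Y] D.quot_class_carrier[OF qD] fg that by blast
  define A where "A = (\<lambda>\<gamma>. twist (\<tau> \<gamma>) k) ` carrier \<Gamma>"
  have A: "finite A" "card A \<le> card (carrier \<Gamma>)"
    using finite_group by (auto simp: A_def card_image_le)
  have cov: "covers ?Q ?g k'" if "k' \<in> A" for k'
    using that order_automorphism.cover_image[OF action_order_automorphism[OF Y] k] tg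
    by (auto simp: A_def)
  obtain X' \<theta> where X': "(X', \<theta>) \<in> quotients C H" "X' \<in> simple_towers C L G (card A)"
    and lub: "is_lub ?Q (quot_class C H X' \<theta>) (insert ?g A)"
    using join_of_covers_in_simple_towers[OF H HL L q A(1) cov] by blast
  let ?J = "quot_class C H X' \<theta>"
  have gA: "insert ?g A \<subseteq> carrier ?Q" using cov g unfolding covers_def by blast
  \<comment> \<open>Twisting is a right action, so it permutes the orbit \<open>A\<close> by right multiplication in \<open>\<Gamma>\<close>.\<close>
  have orbit: "twist (\<tau> \<delta>) ` A = A" if \<delta>: "\<delta> \<in> carrier \<Gamma>" for \<delta>
  proof -
    have "twist (\<tau> \<delta>) ` A = (\<lambda>\<gamma>. twist (\<tau> (\<gamma> \<otimes>\<^bsub>\<Gamma>\<^esub> \<delta>)) k) ` carrier \<Gamma>"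
      unfolding A_def image_image
      by (rule image_cong)
        (use twist_Comp[OF H action_isom[OF Y] action_isom[OF Y] kc] action_mult[OF Y] \<delta> in auto)
    also have "\<dots> = (\<lambda>\<gamma>. twist (\<tau> \<gamma>) k) ` ((\<lambda>\<gamma>. \<gamma> \<otimes>\<^bsub>\<Gamma>\<^esub> \<delta>) ` carrier \<Gamma>)"
      by (simp add: image_image)
    also have "(\<lambda>\<gamma>. \<gamma> \<otimes>\<^bsub>\<Gamma>\<^esub> \<delta>) ` carrier \<Gamma> = carrier \<Gamma>"
    proof (intro equalityI subsetI)
      fix \<gamma> assume \<gamma>: "\<gamma> \<in> carrier \<Gamma>"
      then have "\<gamma> = (\<gamma> \<otimes>\<^bsub>\<Gamma>\<^esub> inv\<^bsub>\<Gamma>\<^esub> \<delta>) \<otimes>\<^bsub>\<Gamma>\<^esub> \<delta>" using \<delta> by (simp add: \<Gamma>.m_assoc)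
      then show "\<gamma> \<in> (\<lambda>\<gamma>. \<gamma> \<otimes>\<^bsub>\<Gamma>\<^esub> \<delta>) ` carrier \<Gamma>" using \<gamma> \<delta> by blast
    qed (use \<delta> in auto)
    finally show ?thesis by (simp add: A_def)
  qed
  have "twist (\<tau> \<delta>) ?J = ?J" if \<delta>: "\<delta> \<in> carrier \<Gamma>" for \<delta>
    using order_automorphism.lub_fixed[OF action_order_automorphism[OF Y \<delta>] lub gA] orbit[OF \<delta>] tg[OF \<delta>]
    by simp
  then have "?J \<in> forget ` carrier (quot_poset D (H, \<tau>))"
    unfolding forget_image_eq_invariants[OF Y]
    by (intro CollectI conjI ballI quot_class_carrier[OF X'(1)])
  then obtain P where P: "P \<in> carrier (quot_poset D (H, \<tau>))" "forget P = ?J"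
    by (metis imageE)
  have "?g \<sqsubseteq>\<^bsub>?Q\<^esub> ?J" using least_Upper_above[OF lub] gA by auto
  then have "P \<in> quot_interval D (H, \<tau>) (G, \<rho>) \<pi>"
    using P forget_le_iff[OF Y D.quot_class_carrier[OF qD] P(1)] fg by (simp add: quot_interval_def)
  then have "P = quot_class D (H, \<tau>) (G, \<rho>) \<pi> \<or> P = quot_class D (H, \<tau>) (H, \<tau>) (Ident D (H, \<tau>))"
    using s by (auto simp: simple_epi_def)
  moreover have "P \<noteq> quot_class D (H, \<tau>) (G, \<rho>) \<pi>"
  proof
    assume "P = quot_class D (H, \<tau>) (G, \<rho>) \<pi>"
    then have "?J = ?g" using P fg by simp
    moreover have "twist (\<tau> \<one>\<^bsub>\<Gamma>\<^esub>) k = k" using action_one[OF Y] twist_Ident[OF H kc] by simp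
    then have "k \<in> A" unfolding A_def by (metis \<Gamma>.one_closed image_eqI)
    then have "k \<sqsubseteq>\<^bsub>?Q\<^esub> ?J" using least_Upper_above[OF lub] gA by auto
    ultimately show False using k Q.le_antisym g by (auto simp: covers_def)
  qed
  ultimately have "?J = ?top" using P forget_Ident[OF Y] by auto
  then have "isom C H X' \<theta>" using quot_class_eq_Ident_iff[OF H X'(1)] by simp
  then have "(H, X') \<in> iso_rel C" using H X'(1) by (auto simp: iso_rel_def quotients_iff)
  moreover have "X' \<in> simple_towers C L G (card (carrier \<Gamma>))"
    by (rule subsetD[OF simple_towers_mono[OF A(2)] X'(2)])
  ultimately show ?thesis by blast
qed

lemma finite_actions: "G \<in> Ob C \<Longrightarrow> finite {\<rho>. (G, \<rho>) \<in> Ob D}"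
  by (rule finite_subset[OF _ finite_PiE[OF finite_group, of "\<lambda>_. carrier (Aut C G)"]])
    (auto simp: Ob_D PiE_def hom_def finite_Aut)

text \<open>
  Every object of \<open>D\<close> over \<open>K\<close> is isomorphic to one whose underlying object is a fixed representative
  \<open>G\<close> of \<open>K\<close>, and a finite group acts on \<open>G\<close> in finitely many ways.
\<close>

lemma finite_iso_classes_over:
  assumes K: "K \<in> iso_classes C"
  shows "finite {K' \<in> iso_classes D. \<exists>X\<in>K'. fst X \<in> K}"
proof -
  obtain G where G: "G \<in> Ob C" "K = iso_rel C `` {G}"
    using K by (auto simp: iso_classes_def elim!: quotientE)
  have "{K' \<in> iso_classes D. \<exists>X\<in>K'. fst X \<in> K} \<subseteq>
    (\<lambda>\<rho>. iso_rel D `` {(G, \<rho>)}) ` {\<rho>. (G, \<rho>) \<in> Ob D}"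
  proof clarify
    fix K' F \<sigma> assume K': "K' \<in> iso_classes D" and F: "(F, \<sigma>) \<in> K'" "fst (F, \<sigma>) \<in> K"
    have X: "(F, \<sigma>) \<in> Ob D" using K' F D.iso_class_subset_Ob by blast
    obtain r where r: "isom C F G r"
      using F G(2) by (auto simp: iso_rel_def elim: isom_inverse)
    obtain \<rho> where \<rho>: "(G, \<rho>) \<in> Ob D" "isom D (F, \<sigma>) (G, \<rho>) r"
      using transport_action[OF X G(1) r] .
    then have rel: "((F, \<sigma>), (G, \<rho>)) \<in> iso_rel D" using X by (auto simp: iso_rel_def)
    obtain Y where Y: "Y \<in> Ob D" "K' = iso_rel D `` {Y}"
      using K' by (auto simp: iso_classes_def elim!: quotientE)
    then have "K' = iso_rel D `` {(F, \<sigma>)}"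
      using F(1) equiv_class_eq[OF D.equiv_iso_rel] by blast
    also have "\<dots> = iso_rel D `` {(G, \<rho>)}"
      by (rule equiv_class_eq[OF D.equiv_iso_rel rel])
    finally show "K' \<in> (\<lambda>\<rho>. iso_rel D `` {(G, \<rho>)}) ` {\<rho>. (G, \<rho>) \<in> Ob D}" using \<rho>(1) by blast
  qed
  then show ?thesis using finite_actions[OF G(1)] by (meson finite_imageI finite_subset)
qed

lemma iso_class_of_Ob: "G \<in> Ob C \<Longrightarrow> iso_rel C `` {G} \<in> iso_classes C \<and> G \<in> iso_rel C `` {G}"
  using equiv_class_self[OF equiv_iso_rel] by (simp add: iso_classes_def quotientI)

lemma finite_simple_epi_D:
  assumes L: "is_level D L" and X: "(G, \<rho>) \<in> L"
  shows "finite {K \<in> iso_classes D. \<exists>Y\<in>K. Y \<in> L \<and> (\<exists>\<pi>. simple_epi D Y (G, \<rho>) \<pi>)}"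
proof -
  obtain L' where L': "is_level C L'" "fst ` L \<subseteq> L'" using level_lies_over_level[OF L] .
  have LOb: "L \<subseteq> Ob D" by (rule D.level_subset_Ob[OF L])
  have GL': "G \<in> L'" using X L'(2) by force
  let ?T = "simple_towers C L' G (card (carrier \<Gamma>))"
  let ?\<K> = "{K \<in> iso_classes C. K \<inter> ?T \<noteq> {}}"
  have "{K \<in> iso_classes D. \<exists>Y\<in>K. Y \<in> L \<and> (\<exists>\<pi>. simple_epi D Y (G, \<rho>) \<pi>)} \<subseteq>
    (\<Union>K\<in>?\<K>. {K' \<in> iso_classes D. \<exists>Y\<in>K'. fst Y \<in> K})"
  proof clarify
    fix K H \<tau> \<pi>
    assume K: "K \<in> iso_classes D" and Y: "(H, \<tau>) \<in> K" "(H, \<tau>) \<in> L"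
      and s: "simple_epi D (H, \<tau>) (G, \<rho>) \<pi>"
    have H: "(H, \<tau>) \<in> Ob D" "H \<in> L'" using Y LOb L'(2) by force+
    obtain X' where X': "X' \<in> ?T" "(H, X') \<in> iso_rel C"
      using simple_epi_D_underlying_tower[OF H(1) _ s level_downward_closed[OF L'(1)] H(2)] X LOb
      by blast
    have "iso_rel C `` {H} \<in> ?\<K>" "H \<in> iso_rel C `` {H}"
      using iso_class_of_Ob[OF action_Ob[OF H(1)]] X' by blast+
    then show "K \<in> (\<Union>K\<in>?\<K>. {K' \<in> iso_classes D. \<exists>Y\<in>K'. fst Y \<in> K})"
      using K Y(1) by fastforce
  qed
  moreover have "finite (\<Union>K\<in>?\<K>. {K' \<in> iso_classes D. \<exists>Y\<in>K'. fst Y \<in> K})"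
    using finite_simple_towers[OF L'(1) GL'] finite_iso_classes_over by blast
  ultimately show ?thesis by (rule finite_subset)
qed

lemma countable_minimal_D: "countable {K \<in> iso_classes D. \<exists>X\<in>K. minimal_object D X}"
proof -
  let ?\<K> = "{K \<in> iso_classes C. \<exists>G\<in>K. minimal_object C G}"
  have "{K \<in> iso_classes D. \<exists>X\<in>K. minimal_object D X} \<subseteq>
    (\<Union>K\<in>?\<K>. {K' \<in> iso_classes D. \<exists>X\<in>K'. fst X \<in> K})"
  proof clarify
    fix K G \<rho> assume K: "K \<in> iso_classes D" "(G, \<rho>) \<in> K" and min: "minimal_object D (G, \<rho>)"
    have m: "minimal_object C G" using min by (rule minimal_object_underlying)
    then have "iso_rel C `` {G} \<in> ?\<K>" "G \<in> iso_rel C `` {G}"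
      using iso_class_of_Ob[of G] by (auto simp: minimal_object_def)
    then show "K \<in> (\<Union>K\<in>?\<K>. {K' \<in> iso_classes D. \<exists>X\<in>K'. fst X \<in> K})"
      using K by (intro UN_I[of "iso_rel C `` {G}"] CollectI conjI bexI[of _ "(G, \<rho>)"]) simp_all
  qed
  moreover have "countable (\<Union>K\<in>?\<K>. {K' \<in> iso_classes D. \<exists>X\<in>K'. fst X \<in> K})"
    by (rule countable_UN[OF countable_minimal]) (blast intro: countable_finite finite_iso_classes_over)
  ultimately show ?thesis by (rule countable_subset)
qed

end

theorem lemma6p20:
  fixes C :: "('o, 'm) cat" and \<Gamma> :: "('g, 'b) monoid_scheme"
  assumes "diamond_category C"
    and "group \<Gamma>"
    and "finite (carrier \<Gamma>)"
  shows "diamond_category (equivariant_cat \<Gamma> C)"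
proof -
  interpret equivariant_objects C \<Gamma>
    using assms by (simp add: equivariant_objects_def equivariant_objects_axioms_def)
  show ?thesis
  proof (intro diamond_category.intro small_category_D diamond_category_axioms.intro)
    fix X assume X: "X \<in> Ob D"
    obtain G \<rho> where [simp]: "X = (G, \<rho>)" by (cases X)
    show "finite (carrier (quot_poset D X))" using finite_quotients_D X by simp
    show "modular_lattice (quot_poset D X)"
      using modular_embedding.modular_lattice_domain[OF forget_modular_embedding] X by simp
    show "finite (carrier (Aut D X))" using finite_Aut_D X by simp
  next
    fix L X assume "is_level D L" "X \<in> L"
    then show "finite {K \<in> iso_classes D. \<exists>H\<in>K. H \<in> L \<and> (\<exists>\<pi>. simple_epi D H X \<pi>)}"
      using finite_simple_epi_D by (cases X) blast
  qed (rule countable_minimal_D)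
qed

end
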